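(* (a) $(1,\emptyset)$ is $\preceq^i_c$-minimum in $\mathfrak{G}_0$. (b) $(2,G_{\varepsilon\mapsto 1-\varepsilon})$ is $\preceq^i_c$-minimum in $\mathfrak{G}_1$. (c) Any $\preceq^i_c$-basis for $\mathfrak{G}_2$ must have size continuum. (d) $(\mathbb{X}_1,G_{f_1})$ is $\preceq^i_c$-minimum in $\mathfrak{G}_3$. Moreover, for each $\kappa\in\{0,1,2,3\}$, neither $(\mathfrak{G}_\kappa,\preceq^i_c)$ nor $(\mathfrak{G}_\kappa,\preceq_c)$ is well-founded. Also, $(\mathfrak{G}_\kappa,\preceq^i_c)$ contains antichains of size continuum for each $\kappa\in\{0,1,2,3\}$, and $(\mathfrak{G}_\kappa,\preceq_c)$ contains antichains of size continuum for each $\kappa\in\{0,1,2\}$.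
   Context: A space is 0DMC if it is zero-dimensional (has a basis of clopen sets), metrizable and compact. If $f:X\to X$ is a function, the graph induced by $f$ is $G_f=\big(\mathrm{Graph}(f)\cup\mathrm{Graph}(f)^{-1}\big)\setminus\Delta(X)$, where $\Delta(X)$ is the diagonal. A coloring of a relation $R$ on $X$ is a map $c$ on $X$ with $c(x)\neq c(y)$ whenever $(x,y)\in R$. The continuous chromatic number (CCN) of $(X,R)$ is the least cardinal $\kappa\leq\aleph_0$ for which there is a continuous coloring $c:X\to\kappa$ of $R$ ($\kappa$ discrete) if it exists, and $2^{\aleph_0}$ otherwise. For $\kappa\leq 3$, $\mathfrak{G}_\kappa$ is the class of graphs $(X,G_f)$ induced by a (total) homeomorphism $f$ of a 0DMC space $X$ with CCN strictly bigger than $\kappa$. $(X,R)\preceq_c(Y,S)$ means that there is a continuous $\varphi:X\to Y$ with $R\subseteq(\varphi\times\varphi)^{-1}(S)$; $(X,R)\preceq^i_c(Y,S)$ means that moreover $\varphi$ can be chosen injective. For a quasi-order $\leq$ on a class $\Gamma$: a basis is a subclass $\mathfrak{B}$ of $\Gamma$ such that every element of $\Gamma$ is $\leq$-above an element of $\mathfrak{B}$; an element of $\Gamma$ is minimum if it is $\leq$-below every element of $\Gamma$; an antichain consists of pairwise $\leq$-incomparable elements; not well-founded means that there is an infinite strictly descending sequence. Here $1=\{0\}$ and $2=\{0,1\}$ are discrete, and $G_{\varepsilon\mapsto 1-\varepsilon}$ is the graph on $2$ induced by the map exchanging $0$ and $1$. $\mathbb{X}_1=\{0^\infty\}\cup\{0^n1^\infty\mid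 n\in\omega\}\subseteq 2^\omega$, and $f_1:\mathbb{X}_1\to\mathbb{X}_1$ is the homeomorphism defined by $f_1(0^\infty)=0^\infty$ and $f_1(0^{2n+\varepsilon}1^\infty)=0^{2n+1-\varepsilon}1^\infty$ for $n\in\omega$, $\varepsilon\in\{0,1\}$. *)

theory Defs
  imports "HOL-Analysis.Analysis" "HOL-Library.Extended" "HOL-Library.Equipollence"
begin

definition zero_dimensional_space :: "'a topology \<Rightarrow> bool" where
  "zero_dimensional_space X \<longleftrightarrow>
     (\<exists>B. (\<forall>U\<in>B. closedin X U) \<and> openin X = arbitrary union_of (\<lambda>U. U \<in> B))"

definition zdmc_space :: "'a topology \<Rightarrow> bool" where
  "zdmc_space X \<longleftrightarrow> zero_dimensional_space X \<and> metrizable_space X \<and> compact_space X"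

text \<open>A space together with a binary relation on it.\<close>
type_synonym 'a tgraph = "'a topology \<times> ('a \<times> 'a) set"

definition fun_graph :: "'a set \<Rightarrow> ('a \<Rightarrow> 'a) \<Rightarrow> ('a \<times> 'a) set" where
  "fun_graph S f = {(x, f x) | x. x \<in> S}"

definition induced_graph :: "'a set \<Rightarrow> ('a \<Rightarrow> 'a) \<Rightarrow> ('a \<times> 'a) set" where
  "induced_graph S f = (fun_graph S f \<union> (fun_graph S f)\<inverse>) - Id_on S"

definition coloring :: "('a \<times> 'a) set \<Rightarrow> ('a \<Rightarrow> 'c) \<Rightarrow> bool" where
  "coloring R c \<longleftrightarrow> (\<forall>(x, y)\<in>R. c x \<noteq> c y)"

text \<open>The cardinals up to aleph 0 are the elements of \<^typ>\<open>enat\<close>; the underlying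
  set of such a cardinal consists of the natural numbers below it.\<close>
definition continuously_colorable :: "'a tgraph \<Rightarrow> enat \<Rightarrow> bool" where
  "continuously_colorable = (\<lambda>(X, R) \<kappa>.
     \<exists>c :: 'a \<Rightarrow> nat. continuous_map X (discrete_topology {i. enat i < \<kappa>}) c \<and> coloring R c)"

text \<open>\<^term>\<open>Fin \<kappa>\<close> is the countable cardinal \<^term>\<open>\<kappa>\<close>, and \<^term>\<open>Pinf\<close>
  (which lies above all of these, including \<^term>\<open>Fin (\<infinity>::enat)\<close>, i.e. aleph 0) stands for
  the value continuum. The value \<^term>\<open>Minf\<close> is not used.\<close>
definition CCN :: "'a tgraph \<Rightarrow> enat extended" where
  "CCN G = (if \<exists>\<kappa>. continuously_colorable G \<kappa>
            then Fin (LEAST \<kappa>. continuously_colorable G \<kappa>) else Pinf)"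

text \<open>The members of the class have their points in the type \<^typ>\<open>'a\<close>. A 0DMC space has at
  most continuum many points, so as soon as \<^typ>\<open>'a\<close> has at least continuum many elements,
  every 0DMC space has a homeomorphic copy among them.\<close>
definition GG :: "nat \<Rightarrow> 'a tgraph set" where
  "GG \<kappa> = {(X, induced_graph (topspace X) f) | X f.
     zdmc_space X \<and> homeomorphic_map X X f \<and>
     Fin (enat \<kappa>) < CCN (X, induced_graph (topspace X) f)}"

text \<open>The two sides of a reduction may have points of different types, so that graphs on
  spaces of different types can be compared.\<close>
definition reducible_c :: "'a tgraph \<Rightarrow> 'b tgraph \<Rightarrow> bool"  (infix "\<preceq>\<^sub>c" 50) where
  "G \<preceq>\<^sub>c H \<longleftrightarrow> (\<exists>\<phi>. continuous_map (fst G) (fst H) \<phi> \<and>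
     (\<forall>(x, y)\<in>snd G. (\<phi> x, \<phi> y) \<in> snd H))"

definition reducible_ic :: "'a tgraph \<Rightarrow> 'b tgraph \<Rightarrow> bool"  (infix "\<preceq>\<^sup>i\<^sub>c" 50) where
  "G \<preceq>\<^sup>i\<^sub>c H \<longleftrightarrow> (\<exists>\<phi>. continuous_map (fst G) (fst H) \<phi> \<and> inj_on \<phi> (topspace (fst G)) \<and>
     (\<forall>(x, y)\<in>snd G. (\<phi> x, \<phi> y) \<in> snd H))"

definition tgraph_iso :: "'a tgraph \<Rightarrow> 'b tgraph \<Rightarrow> bool" where
  "tgraph_iso G H \<longleftrightarrow> (\<exists>\<phi>. homeomorphic_map (fst G) (fst H) \<phi> \<and>
     (\<forall>x\<in>topspace (fst G). \<forall>y\<in>topspace (fst G). (x, y) \<in> snd G \<longleftrightarrow> (\<phi> x, \<phi> y) \<in> snd H))"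

text \<open>A basis may contain arbitrarily many isomorphic copies of a graph (the whole class is a basis),
  so the exact size of a basis is only meaningful up to isomorphism.\<close>
definition iso_classes :: "'a tgraph set \<Rightarrow> 'a tgraph set set" where
  "iso_classes B = (\<lambda>G. {H. tgraph_iso G H}) ` B"

definition is_basis :: "('g \<Rightarrow> 'g \<Rightarrow> bool) \<Rightarrow> 'g set \<Rightarrow> 'g set \<Rightarrow> bool" where
  "is_basis le \<Gamma> B \<longleftrightarrow> B \<subseteq> \<Gamma> \<and> (\<forall>G\<in>\<Gamma>. \<exists>H\<in>B. le H G)"

definition is_antichain :: "('g \<Rightarrow> 'g \<Rightarrow> bool) \<Rightarrow> 'g set \<Rightarrow> 'g set \<Rightarrow> bool" where
  "is_antichain le \<Gamma> A \<longleftrightarrow> A \<subseteq> \<Gamma> \<and> (\<forall>G\<in>A. \<forall>H\<in>A. G \<noteq> H \<longrightarrow> \<not> le G H \<and> \<not> le H G)"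

definition not_well_founded :: "('g \<Rightarrow> 'g \<Rightarrow> bool) \<Rightarrow> 'g set \<Rightarrow> bool" where
  "not_well_founded le \<Gamma> \<longleftrightarrow>
     (\<exists>s :: nat \<Rightarrow> 'g. \<forall>n. s n \<in> \<Gamma> \<and> le (s (Suc n)) (s n) \<and> \<not> le (s n) (s (Suc n)))"

abbreviation continuum :: "nat set set" where
  "continuum \<equiv> UNIV"

definition one_graph :: "nat tgraph" where
  "one_graph = (discrete_topology {0}, {})"

definition two_graph :: "nat tgraph" where
  "two_graph = (discrete_topology {0, 1}, induced_graph {0, 1} (\<lambda>\<epsilon>. 1 - \<epsilon>))"

definition cantor_space :: "(nat \<Rightarrow> nat) topology" where
  "cantor_space = product_topology (\<lambda>_. discrete_topology {0, 1}) UNIV"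

definition zeros :: "nat \<Rightarrow> nat" where
  "zeros = (\<lambda>_. 0)"

definition zeros_ones :: "nat \<Rightarrow> nat \<Rightarrow> nat" where
  "zeros_ones n = (\<lambda>i. if i < n then 0 else 1)"

definition X1_space :: "(nat \<Rightarrow> nat) topology" where
  "X1_space = subtopology cantor_space (insert zeros (range zeros_ones))"

definition f1 :: "(nat \<Rightarrow> nat) \<Rightarrow> nat \<Rightarrow> nat" where
  "f1 x = (if x = zeros then zeros
     else THE y. \<exists>n. \<exists>\<epsilon>\<in>{0, 1}. x = zeros_ones (2 * n + \<epsilon>) \<and> y = zeros_ones (2 * n + 1 - \<epsilon>))"

lemma zeros_ones_inject: "zeros_ones m = zeros_ones n \<longleftrightarrow> m = n"
proof
  assume h: "zeros_ones m = zeros_ones n"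
  have "\<not> m < n"
    using fun_cong[OF h, of m] by (simp add: zeros_ones_def split: if_splits)
  moreover have "\<not> n < m"
    using fun_cong[OF h, of n] by (simp add: zeros_ones_def split: if_splits)
  ultimately show "m = n"
    by simp
qed simp

lemma zeros_ones_neq_zeros: "zeros_ones n \<noteq> zeros"
proof
  assume "zeros_ones n = zeros"
  from fun_cong[OF this, of n] show False by (simp add: zeros_ones_def zeros_def)
qed

lemma f1_zeros: "f1 zeros = zeros"
  by (simp add: f1_def)

lemma f1_zeros_ones:
  assumes "\<epsilon> \<in> {0, 1}"
  shows "f1 (zeros_ones (2 * n + \<epsilon>)) = zeros_ones (2 * n + 1 - \<epsilon>)"
proof -
  have *: "2 * m + 1 - \<delta> = 2 * n + 1 - \<epsilon>"
    if "2 * n + \<epsilon> = 2 * m + \<delta>" "\<delta> \<in> {0, 1}" for m \<delta>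
  proof -
    from that(1) have "(2 * n + \<epsilon>) mod 2 = (2 * m + \<delta>) mod 2"
      by (rule arg_cong)
    then have "\<epsilon> = \<delta>"
      using assms that(2) by auto
    with that(1) show ?thesis
      by simp
  qed
  have "(THE y. \<exists>m. \<exists>\<delta>\<in>{0, 1}. zeros_ones (2 * n + \<epsilon>) = zeros_ones (2 * m + \<delta>)
      \<and> y = zeros_ones (2 * m + 1 - \<delta>)) = zeros_ones (2 * n + 1 - \<epsilon>)"
  proof (rule the_equality)
    show "\<exists>m. \<exists>\<delta>\<in>{0, 1}. zeros_ones (2 * n + \<epsilon>) = zeros_ones (2 * m + \<delta>)
        \<and> zeros_ones (2 * n + 1 - \<epsilon>) = zeros_ones (2 * m + 1 - \<delta>)"
      using assms by blast
  next
    fix y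
    assume "\<exists>m. \<exists>\<delta>\<in>{0, 1}. zeros_ones (2 * n + \<epsilon>) = zeros_ones (2 * m + \<delta>)
        \<and> y = zeros_ones (2 * m + 1 - \<delta>)"
    then obtain m \<delta> where \<delta>: "\<delta> \<in> {0, 1}" and eq: "2 * n + \<epsilon> = 2 * m + \<delta>"
      and y: "y = zeros_ones (2 * m + 1 - \<delta>)"
      unfolding zeros_ones_inject by blast
    show "y = zeros_ones (2 * n + 1 - \<epsilon>)"
      unfolding y *[OF eq \<delta>] by (rule refl)
  qed
  then show ?thesis
    by (simp only: f1_def zeros_ones_neq_zeros if_False)
qed

definition X1_graph :: "(nat \<Rightarrow> nat) tgraph" where
  "X1_graph = (X1_space, induced_graph (topspace X1_space) f1)"

end

theory Submission
  imports Defs "HOL-Number_Theory.Cong" "HOL-Library.Discrete_Functions"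
begin

text \<open>The classes are described by the absence of continuous colourings, and each part comes down to a
compactness argument together with one of two families of examples.

Having no colouring with no colour means that the space is non-empty, and having none with one colour means that
there is an edge; this gives the first two minimum graphs. For three colours the dichotomy is as follows. If every
point has a clopen neighbourhood without inner edges, a greedy argument over a finite cover yields a continuous
3-colouring (\<open>three_colorable\<close>), because the graph of a homeomorphism has degree at most two. Otherwise some fixed
point is a limit of moved points, and a sequence of pairs \<open>y, f y\<close> shrinking to it carries a copy of
\<open>X1_graph\<close>, which admits no continuous colouring at all.

The first family consists of graphs on the space of \<open>X1_graph\<close> whose homeomorphism permutes the isolated points
in odd cycles, one of length \<open>2 * k + 1\<close> for each \<open>k\<close> in an infinite set \<open>S\<close> of positive numbers. As the cycles
accumulate at a point there is no continuous colouring, so these graphs are in all four classes. An odd cycle only maps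
to odd cycles that are not longer, and injectively only to those of the same length
(\<open>cycle_image\<close>). Dropping the short cycles one after the other thus yields a sequence that descends for
both quasi-orders, and almost disjoint sets \<open>S\<close> yield an antichain for injective reductions.

The second family consists of odometers, translations by 1 of a product of cyclic groups with pairwise
coprime odd orders \<open>p i\<close>. They have no continuous 2-colouring since they return near any point after an odd
time. A reduction from one odometer to another follows orbits with steps of one place forward or backward, and over an
odd period these add up to a non-zero displacement; continuity then excludes new large orders in the target
(\<open>no_reduction_between_odometers\<close>). Almost disjoint sets of primes give the antichain of size continuum for
\<open>\<preceq>\<^sub>c\<close>. Moreover odometers are rigid: a graph without 2-colouring that reduces injectively
to an odometer is also above it (\<open>odometer_graph_rigid\<close>). Hence a basis for two colours needs a
different element below each odometer of the family. Conversely, there are at most continuum many graphs up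
to isomorphism, because a countable clopen base makes the graph determined by a set of natural numbers
(\<open>signature_determines_graph\<close>).\<close>

section \<open>Colourings and reductions\<close>

lemma mem_induced_graph:
  "(x, y) \<in> induced_graph S f \<longleftrightarrow> x \<noteq> y \<and> (x \<in> S \<and> y = f x \<or> y \<in> S \<and> x = f y)"
  by (auto simp: induced_graph_def fun_graph_def Id_on_def)

lemma continuous_map_into_discrete:
  "continuous_map X (discrete_topology A) c \<longleftrightarrow>
     (\<forall>x \<in> topspace X. c x \<in> A) \<and> (\<forall>i \<in> A. openin X {x \<in> topspace X. c x = i})"
  (is "?L \<longleftrightarrow> ?R")
proof
  assume L: ?L
  have "openin X {x \<in> topspace X. c x = i}" if "i \<in> A" for i
    using openin_continuous_map_preimage[OF L, of "{i}"] that by simp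
  then show ?R
    using L by (auto simp: continuous_map_def)
next
  assume R: ?R
  have "openin X {x \<in> topspace X. c x \<in> U}" if "U \<subseteq> A" for U
  proof -
    have "{x \<in> topspace X. c x \<in> U} = (\<Union>i\<in>U. {x \<in> topspace X. c x = i})"
      by auto
    with R that show ?thesis by (auto intro!: openin_Union)
  qed
  with R show ?L
    by (auto simp: continuous_map_def)
qed

lemma openin_preimage_discrete_map:
  assumes "continuous_map X (discrete_topology A) c"
  shows "openin X {x \<in> topspace X. P (c x)}"
proof -
  have "{x \<in> topspace X. P (c x)} = {x \<in> topspace X. c x \<in> {i \<in> A. P i}}"
    using assms by (auto simp: continuous_map_def)
  then show ?thesis
    using openin_continuous_map_preimage[OF assms, of "{i \<in> A. P i}"] by simp
qed

lemma colorable_mono: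
  assumes "continuously_colorable G \<kappa>" "\<kappa> \<le> \<kappa>'"
  shows "continuously_colorable G \<kappa>'"
proof -
  obtain X R where G: "G = (X, R)" by fastforce
  obtain c where c: "continuous_map X (discrete_topology {i. enat i < \<kappa>}) c" "coloring R c"
    using assms by (auto simp: continuously_colorable_def G)
  have "openin X {x \<in> topspace X. c x = i}" for i
    using openin_preimage_discrete_map[OF c(1), of "\<lambda>j. j = i"] by simp
  with c have "continuous_map X (discrete_topology {i. enat i < \<kappa>'}) c"
    using assms(2) by (auto simp: continuous_map_into_discrete intro: less_le_trans)
  with c show ?thesis
    by (auto simp: continuously_colorable_def G)
qed

text \<open>Colourability is upward closed in the number of colours, so all that \<open>CCN\<close> contributes to
  membership in \<open>GG k\<close> is the absence of a continuous \<open>k\<close>-colouring.\<close>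
lemma less_CCN_iff:
  "Fin (enat k) < CCN G \<longleftrightarrow> \<not> continuously_colorable G (enat k)"
proof (cases "\<exists>\<kappa>. continuously_colorable G \<kappa>")
  case True
  define m where "m = (LEAST \<kappa>. continuously_colorable G \<kappa>)"
  have m: "continuously_colorable G m" "\<And>\<kappa>. continuously_colorable G \<kappa> \<Longrightarrow> m \<le> \<kappa>"
    using True unfolding m_def by (auto intro: LeastI Least_le)
  have "CCN G = Fin m"
    using True by (simp add: CCN_def m_def)
  moreover have "continuously_colorable G (enat k) \<longleftrightarrow> m \<le> enat k"
    using m colorable_mono by blast
  ultimately show ?thesis by (simp add: not_le)
next
  case False
  then show ?thesis by (simp add: CCN_def)
qed

lemma GG_iff:
  "G \<in> GG k \<longleftrightarrow> (\<exists>X f. G = (X, induced_graph (topspace X) f) \<and> zdmc_space X \<and>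
     homeomorphic_map X X f \<and> \<not> continuously_colorable G (enat k))"
  by (auto simp: GG_def less_CCN_iff)

text \<open>A graph in \<open>GG 3\<close> therefore serves as an example in every smaller class as well.\<close>
lemma GG_antimono: "k \<le> l \<Longrightarrow> GG l \<subseteq> GG k"
  using colorable_mono by (fastforce simp: GG_iff)

text \<open>A colouring of the target pulls back along a continuous homomorphism.\<close>
lemma reducible_c_colorable:
  assumes "G \<preceq>\<^sub>c H" "continuously_colorable H \<kappa>"
  shows "continuously_colorable G \<kappa>"
proof -
  obtain X R Y S where G: "G = (X, R)" "H = (Y, S)" by fastforce
  obtain \<phi> where \<phi>: "continuous_map X Y \<phi>" "\<forall>(x, y)\<in>R. (\<phi> x, \<phi> y) \<in> S"
    using assms by (auto simp: reducible_c_def G)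
  obtain c where c: "continuous_map Y (discrete_topology {i. enat i < \<kappa>}) c" "coloring S c"
    using assms by (auto simp: continuously_colorable_def G)
  have "continuous_map X (discrete_topology {i. enat i < \<kappa>}) (c \<circ> \<phi>)"
    using \<phi> c continuous_map_compose by blast
  moreover have "coloring R (c \<circ> \<phi>)"
    using \<phi> c by (fastforce simp: coloring_def)
  ultimately show ?thesis
    by (auto simp: continuously_colorable_def G)
qed

lemma reducible_ic_imp_c: "G \<preceq>\<^sup>i\<^sub>c H \<Longrightarrow> G \<preceq>\<^sub>c H"
  by (auto simp: reducible_ic_def reducible_c_def)

lemma reducible_c_trans: "G \<preceq>\<^sub>c H \<Longrightarrow> H \<preceq>\<^sub>c K \<Longrightarrow> G \<preceq>\<^sub>c K"
proof -
  assume "G \<preceq>\<^sub>c H" "H \<preceq>\<^sub>c K"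
  then obtain \<phi> \<psi> where 1: "continuous_map (fst G) (fst H) \<phi>"
    "\<forall>(x, y)\<in>snd G. (\<phi> x, \<phi> y) \<in> snd H"
    and 2: "continuous_map (fst H) (fst K) \<psi>"
    "\<forall>(x, y)\<in>snd H. (\<psi> x, \<psi> y) \<in> snd K"
    by (auto simp: reducible_c_def)
  then show ?thesis
    unfolding reducible_c_def
    by (intro exI[of _ "\<psi> \<circ> \<phi>"]) (fastforce intro: continuous_map_compose)
qed

lemma reducible_ic_trans: "G \<preceq>\<^sup>i\<^sub>c H \<Longrightarrow> H \<preceq>\<^sup>i\<^sub>c K \<Longrightarrow> G \<preceq>\<^sup>i\<^sub>c K"
proof -
  assume "G \<preceq>\<^sup>i\<^sub>c H" "H \<preceq>\<^sup>i\<^sub>c K"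
  then obtain \<phi> \<psi> where 1: "continuous_map (fst G) (fst H) \<phi>" "inj_on \<phi> (topspace (fst G))"
    "\<forall>(x, y)\<in>snd G. (\<phi> x, \<phi> y) \<in> snd H"
    and 2: "continuous_map (fst H) (fst K) \<psi>" "inj_on \<psi> (topspace (fst H))"
    "\<forall>(x, y)\<in>snd H. (\<psi> x, \<psi> y) \<in> snd K"
    by (auto simp: reducible_ic_def)
  have "inj_on (\<psi> \<circ> \<phi>) (topspace (fst G))"
    using 1 2 by (meson comp_inj_on continuous_map_image_subset_topspace inj_on_subset)
  with 1 2 show ?thesis
    unfolding reducible_ic_def
    by (intro exI[of _ "\<psi> \<circ> \<phi>"]) (fastforce intro: continuous_map_compose)
qed

lemma reducible_ic_refl: "G \<preceq>\<^sup>i\<^sub>c G"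
  unfolding reducible_ic_def by (intro exI[of _ id]) auto

section \<open>Zero-dimensional compact metrizable spaces\<close>

lemma zero_dimensional_space_iff:
  "zero_dimensional_space X \<longleftrightarrow>
     (\<forall>U x. openin X U \<and> x \<in> U \<longrightarrow> (\<exists>V. openin X V \<and> closedin X V \<and> x \<in> V \<and> V \<subseteq> U))"
  (is "?L \<longleftrightarrow> ?R")
proof
  assume ?L
  then obtain B where B: "\<forall>U\<in>B. closedin X U" "openin X = arbitrary union_of (\<lambda>U. U \<in> B)"
    by (auto simp: zero_dimensional_space_def)
  have open_B: "openin X V" if "V \<in> B" for V
    using that by (simp add: B(2) arbitrary_union_of_inc)
  have "\<exists>V\<in>B. x \<in> V \<and> V \<subseteq> U" if "openin X U" "x \<in> U" for U x
    using that by (auto simp: B(2) arbitrary_union_of_alt)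
  then show ?R
    using B(1) open_B by metis
next
  assume R: ?R
  have "openin X = arbitrary union_of (\<lambda>U. U \<in> {V. openin X V \<and> closedin X V})"
  proof (rule openin_topology_base_unique[THEN iffD2], intro conjI allI impI)
    fix U x assume "openin X U \<and> x \<in> U"
    with R obtain V where "openin X V" "closedin X V" "x \<in> V" "V \<subseteq> U" by metis
    then show "\<exists>V. V \<in> {V. openin X V \<and> closedin X V} \<and> x \<in> V \<and> V \<subseteq> U" by auto
  qed simp
  then show ?L
    unfolding zero_dimensional_space_def by (intro exI[of _ "{V. openin X V \<and> closedin X V}"]) auto
qed

lemma zdmc_clopen_nbhd:
  assumes "zdmc_space X" "openin X U" "x \<in> U"
  obtains V where "openin X V" "closedin X V" "x \<in> V" "V \<subseteq> U"
  using assms unfolding zdmc_space_def zero_dimensional_space_iff by blast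

lemma zdmc_Hausdorff: "zdmc_space X \<Longrightarrow> Hausdorff_space X"
  by (simp add: zdmc_space_def metrizable_imp_Hausdorff_space)

lemma zdmc_compact: "zdmc_space X \<Longrightarrow> compact_space X"
  by (simp add: zdmc_space_def)

lemma zdmc_closed_subspace:
  assumes "zdmc_space X" "closedin X S"
  shows "zdmc_space (subtopology X S)"
proof -
  have "zero_dimensional_space (subtopology X S)"
    unfolding zero_dimensional_space_iff
  proof (intro allI impI)
    fix U x assume U: "openin (subtopology X S) U \<and> x \<in> U"
    then obtain W where W: "openin X W" "U = W \<inter> S"
      by (auto simp: openin_subtopology)
    obtain V where "openin X V" "closedin X V" "x \<in> V" "V \<subseteq> W"
      using zdmc_clopen_nbhd[OF assms(1) W(1), of x] U W by auto
    moreover from this have "openin (subtopology X S) (V \<inter> S)" "closedin (subtopology X S) (V \<inter> S)"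
      unfolding openin_subtopology closedin_subtopology by blast+
    ultimately show "\<exists>V. openin (subtopology X S) V \<and> closedin (subtopology X S) V \<and> x \<in> V \<and> V \<subseteq> U"
      using U W(2) by (intro exI[of _ "V \<inter> S"]) blast
  qed
  then show ?thesis
    using assms closedin_compact_space compact_space_subtopology metrizable_space_subtopology
    by (auto simp: zdmc_space_def)
qed

lemma zdmc_homeomorphic:
  assumes "homeomorphic_map X Y h" "zdmc_space X"
  shows "zdmc_space Y"
proof -
  have hs: "X homeomorphic_space Y"
    using assms(1) homeomorphic_map_imp_homeomorphic_space by blast
  have "zero_dimensional_space Y"
    unfolding zero_dimensional_space_iff
  proof (intro allI impI)
    fix U y assume U: "openin Y U \<and> y \<in> U"
    then have "y \<in> topspace Y" using openin_subset by blast
    then obtain x where x: "x \<in> topspace X" "h x = y"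
      using assms(1) by (metis (no_types, lifting) homeomorphic_imp_surjective_map imageE)
    have "openin X {x \<in> topspace X. h x \<in> U}"
      using U assms(1) homeomorphic_imp_continuous_map openin_continuous_map_preimage by blast
    then obtain V where V: "openin X V" "closedin X V" "x \<in> V" "V \<subseteq> {x \<in> topspace X. h x \<in> U}"
      using zdmc_clopen_nbhd[OF assms(2), of _ x] x U by blast
    then show "\<exists>V. openin Y V \<and> closedin Y V \<and> y \<in> V \<and> V \<subseteq> U"
      using x assms(1)
      by (intro exI[of _ "h ` V"])
        (auto simp: homeomorphic_map_openness_eq homeomorphic_map_closedness_eq
          dest: homeomorphic_imp_open_map homeomorphic_imp_closed_map simp: open_map_def closed_map_def)
  qed
  with assms hs show ?thesis
    using homeomorphic_metrizable_space homeomorphic_compact_space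
    by (auto simp: zdmc_space_def)
qed

section \<open>Countable products of finite discrete spaces\<close>

abbreviation sequence_space :: "(nat \<Rightarrow> 'a set) \<Rightarrow> (nat \<Rightarrow> 'a) topology" where
  "sequence_space A \<equiv> product_topology (\<lambda>i. discrete_topology (A i)) UNIV"

lemma topspace_sequence_space: "x \<in> topspace (sequence_space A) \<longleftrightarrow> (\<forall>i. x i \<in> A i)"
  by (simp add: PiE_UNIV_domain Pi_iff)

lemma clopen_coordinate:
  "openin (sequence_space A) {x \<in> topspace (sequence_space A). x i = a}"
  "closedin (sequence_space A) {x \<in> topspace (sequence_space A). x i = a}"
proof -
  have c: "continuous_map (sequence_space A) (discrete_topology (A i)) (\<lambda>x. x i)"
    by (rule continuous_map_product_projection) simp
  show "openin (sequence_space A) {x \<in> topspace (sequence_space A). x i = a}"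
    using openin_preimage_discrete_map[OF c, of "\<lambda>b. b = a"] by blast
  have "openin (sequence_space A) {x \<in> topspace (sequence_space A). x i \<noteq> a}"
    using openin_preimage_discrete_map[OF c, of "\<lambda>b. b \<noteq> a"] by blast
  moreover have "topspace (sequence_space A) - {x \<in> topspace (sequence_space A). x i = a}
      = {x \<in> topspace (sequence_space A). x i \<noteq> a}" by auto
  ultimately show "closedin (sequence_space A) {x \<in> topspace (sequence_space A). x i = a}"
    by (metis (lifting) closedin_def mem_Collect_eq subsetI)
qed

text \<open>The cylinders at \<open>x\<close> form a neighbourhood base at \<open>x\<close> when \<open>x\<close> lies in the space.\<close>
definition cylinder :: "(nat \<Rightarrow> 'a set) \<Rightarrow> (nat \<Rightarrow> 'a) \<Rightarrow> nat \<Rightarrow> (nat \<Rightarrow> 'a) set" where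
  "cylinder A x n = {y \<in> topspace (sequence_space A). \<forall>i<n. y i = x i}"

lemma clopen_cylinder:
  "openin (sequence_space A) (cylinder A x n)" "closedin (sequence_space A) (cylinder A x n)"
proof -
  have "openin (sequence_space A) (cylinder A x n) \<and> closedin (sequence_space A) (cylinder A x n)"
  proof (induction n)
    case 0
    then show ?case by (simp add: cylinder_def del: topspace_product_topology)
  next
    case (Suc n)
    have "cylinder A x (Suc n) = cylinder A x n \<inter> {y \<in> topspace (sequence_space A). y n = x n}"
      by (auto simp: cylinder_def less_Suc_eq)
    then show ?case
      using Suc clopen_coordinate[of A n "x n"] by (simp only: closedin_Int openin_Int)
  qed
  then show "openin (sequence_space A) (cylinder A x n)" "closedin (sequence_space A) (cylinder A x n)"
    by auto
qed

lemma open_contains_cylinder: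
  assumes "openin (sequence_space A) U" "x \<in> U"
  obtains n where "cylinder A x n \<subseteq> U"
proof -
  obtain V where V: "finite {i \<in> UNIV. V i \<noteq> topspace (discrete_topology (A i))}"
     "x \<in> Pi\<^sub>E UNIV V" "Pi\<^sub>E UNIV V \<subseteq> U"
    using assms(1)[unfolded openin_product_topology_alt, rule_format, OF assms(2)] by blast
  obtain n where n: "\<And>i. V i \<noteq> A i \<Longrightarrow> i < n"
    using V(1) by (auto simp: finite_nat_set_iff_bounded)
  have sub: "cylinder A x n \<subseteq> Pi\<^sub>E UNIV V"
  proof
    fix y assume y: "y \<in> cylinder A x n"
    have "y i \<in> V i" for i
      using y V(2) n[of i] by (cases "i < n") (auto simp: cylinder_def PiE_UNIV_domain Pi_iff)
    then show "y \<in> Pi\<^sub>E UNIV V" by auto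
  qed
  show ?thesis
    by (rule that[OF order_trans[OF sub V(3)]])
qed

lemma zdmc_sequence_space:
  assumes "\<And>i. finite (A i)"
  shows "zdmc_space (sequence_space A)"
proof -
  have "zero_dimensional_space (sequence_space A)"
    unfolding zero_dimensional_space_iff
  proof (intro allI impI)
    fix U x assume U: "openin (sequence_space A) U \<and> x \<in> U"
    obtain n where "cylinder A x n \<subseteq> U"
      using open_contains_cylinder[of A U x] U by blast
    moreover have "x \<in> topspace (sequence_space A)"
      using U openin_subset by blast
    then have "x \<in> cylinder A x n" by (auto simp: cylinder_def)
    ultimately show "\<exists>V. openin (sequence_space A) V \<and> closedin (sequence_space A) V \<and> x \<in> V \<and> V \<subseteq> U"
      using clopen_cylinder by metis
  qed
  moreover have "metrizable_space (sequence_space A)"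
    by (simp add: metrizable_space_product_topology metrizable_space_discrete_topology)
  moreover have "compact_space (sequence_space A)"
    using assms by (simp add: compact_space_product_topology compact_space_discrete_topology)
  ultimately show ?thesis by (simp add: zdmc_space_def)
qed

lemma continuous_map_into_sequence_space:
  "continuous_map X (sequence_space A) f \<longleftrightarrow>
    (\<forall>i. continuous_map X (discrete_topology (A i)) (\<lambda>x. f x i))"
  by (simp add: continuous_map_componentwise_UNIV)

text \<open>Every point has a cylinder on which membership in \<open>U\<close> is constant; by compactness finitely many of
  these cover the space, and the longest of them gives \<open>n\<close>.\<close>
lemma clopen_finitely_determined:
  assumes "\<And>i. finite (A i)" "openin (sequence_space A) U" "closedin (sequence_space A) U"
  obtains n where "\<And>x y. x \<in> topspace (sequence_space A) \<Longrightarrow> y \<in> cylinder A x n \<Longrightarrow> y \<in> U \<longleftrightarrow> x \<in> U"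
proof -
  let ?X = "sequence_space A"
  have "\<exists>n. (cylinder A x n \<subseteq> U \<or> cylinder A x n \<subseteq> topspace ?X - U)" if "x \<in> topspace ?X" for x
  proof (cases "x \<in> U")
    case True
    then show ?thesis using open_contains_cylinder[OF assms(2)] by metis
  next
    case False
    have "openin ?X (topspace ?X - U)" using assms(3) by blast
    with False that show ?thesis using open_contains_cylinder[of A "topspace ?X - U" x] by blast
  qed
  then obtain N where N: "\<And>x. x \<in> topspace ?X \<Longrightarrow>
      cylinder A x (N x) \<subseteq> U \<or> cylinder A x (N x) \<subseteq> topspace ?X - U"
    by metis
  have "compact_space ?X"
    by (rule zdmc_compact[OF zdmc_sequence_space[OF assms(1)]])
  then obtain \<F> where F: "finite \<F>" "\<F> \<subseteq> (\<lambda>x. cylinder A x (N x)) ` topspace ?X" "topspace ?X \<subseteq> \<Union>\<F>"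
  proof -
    have "topspace ?X \<subseteq> \<Union>((\<lambda>x. cylinder A x (N x)) ` topspace ?X)"
      by (auto simp: cylinder_def)
    moreover have "\<forall>V \<in> (\<lambda>x. cylinder A x (N x)) ` topspace ?X. openin ?X V"
      using clopen_cylinder by blast
    ultimately have "\<exists>\<F>. finite \<F> \<and> \<F> \<subseteq> (\<lambda>x. cylinder A x (N x)) ` topspace ?X \<and> topspace ?X \<subseteq> \<Union>\<F>"
      using \<open>compact_space ?X\<close>[unfolded compact_space_alt, rule_format,
          of "(\<lambda>x. cylinder A x (N x)) ` topspace ?X"] by blast
    then show thesis using that by blast
  qed
  then obtain F where F': "finite F" "F \<subseteq> topspace ?X" "\<F> = (\<lambda>x. cylinder A x (N x)) ` F"
    by (meson finite_subset_image)
  obtain n where n: "\<And>x. x \<in> F \<Longrightarrow> N x \<le> n"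
    using F'(1) by (metis Max_ge finite_imageI image_eqI)
  show ?thesis
  proof (rule that)
    fix x y assume x: "x \<in> topspace ?X" and y: "y \<in> cylinder A x n"
    then obtain z where z: "z \<in> F" "x \<in> cylinder A z (N z)"
      using F(3) F'(3) by blast
    then have "y \<in> cylinder A z (N z)"
      using y n[OF z(1)] by (auto simp: cylinder_def)
    then show "y \<in> U \<longleftrightarrow> x \<in> U"
      using N[of z] z F'(2) by blast
  qed
qed


section \<open>Permutations of a convergent sequence\<close>

lemma topspace_X1_space: "topspace X1_space = insert zeros (range zeros_ones)"
  by (auto simp: X1_space_def cantor_space_def zeros_def zeros_ones_def PiE_UNIV_domain)

text \<open>The points of \<open>X1_space\<close> are the non-decreasing binary sequences, which is a closed condition on
  consecutive coordinates.\<close>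
lemma closedin_cantor_X1: "closedin cantor_space (insert zeros (range zeros_ones))"
proof -
  let ?A = "\<lambda>_::nat. {0, 1::nat}"
  have eq: "insert zeros (range zeros_ones) =
      (\<Inter>i. {x \<in> topspace (sequence_space ?A). x i = 0} \<union> {x \<in> topspace (sequence_space ?A). x (Suc i) = 1})"
    (is "_ = ?R")
  proof
    show "insert zeros (range zeros_ones) \<subseteq> ?R"
      by (auto simp: zeros_def zeros_ones_def PiE_UNIV_domain split: if_splits)
    show "?R \<subseteq> insert zeros (range zeros_ones)"
    proof
      fix x assume "x \<in> ?R"
      then have "(x i = 0 \<or> x i = 1) \<and> (x i = 0 \<or> x (Suc i) = 1)" for i
        by (auto simp: PiE_UNIV_domain Pi_iff)
      then have x: "x i = 0 \<or> x i = 1" "x i = 1 \<Longrightarrow> x (Suc i) = 1" for i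
        by (metis zero_neq_one)+
      show "x \<in> insert zeros (range zeros_ones)"
      proof (cases "\<exists>i. x i = 1")
        case True
        define n where "n = (LEAST i. x i = 1)"
        have "x (n + j) = 1" for j
          by (induction j) (use True x(2) in \<open>auto simp: n_def intro: LeastI\<close>)
        moreover have "x i = 0" if "i < n" for i
          using that x(1) not_less_Least unfolding n_def by blast
        ultimately have "x i = zeros_ones n i" for i
          using le_Suc_ex[of n i] by (auto simp: zeros_ones_def not_less)
        then show ?thesis by auto
      next
        case False
        with x(1) have "x i = zeros i" for i by (auto simp: zeros_def)
        then show ?thesis by auto
      qed
    qed
  qed
  have "closedin (sequence_space ?A) ?R"
    by (intro closedin_INT closedin_Un clopen_coordinate) auto
  then show ?thesis
    by (simp only: eq cantor_space_def)
qed

lemma zdmc_X1_space: "zdmc_space X1_space"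
  unfolding X1_space_def
  by (rule zdmc_closed_subspace[OF _ closedin_cantor_X1])
     (simp add: cantor_space_def zdmc_sequence_space)

lemma X1_cases:
  assumes "x \<in> topspace X1_space"
  obtains "x = zeros" | n where "x = zeros_ones n"
  using assms by (auto simp: topspace_X1_space)

text \<open>The space is a sequence of isolated points \<open>zeros_ones n\<close> together with its limit \<open>zeros\<close>.\<close>
lemma openin_X1_space:
  "openin X1_space U \<longleftrightarrow>
     U \<subseteq> topspace X1_space \<and> (zeros \<in> U \<longrightarrow> (\<exists>m. \<forall>n\<ge>m. zeros_ones n \<in> U))"
proof -
  let ?A = "\<lambda>_::nat. {0, 1::nat}"
  have inA: "zeros \<in> topspace (sequence_space ?A)" "zeros_ones n \<in> topspace (sequence_space ?A)" for n
    by (auto simp: zeros_def zeros_ones_def PiE_UNIV_domain)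
  have cyl: "openin X1_space (cylinder ?A x n \<inter> topspace X1_space)" for x n
  proof -
    have "openin (subtopology (sequence_space ?A) (insert zeros (range zeros_ones)))
        (cylinder ?A x n \<inter> insert zeros (range zeros_ones))"
      by (rule openin_subtopology_Int[OF clopen_cylinder(1)])
    then show ?thesis by (simp only: topspace_X1_space) (simp only: X1_space_def cantor_space_def)
  qed
  show ?thesis
  proof (intro iffI conjI impI)
    assume U: "openin X1_space U"
    show "U \<subseteq> topspace X1_space" by (rule openin_subset[OF U])
    assume z: "zeros \<in> U"
    obtain W where W: "openin (sequence_space ?A) W" "U = W \<inter> insert zeros (range zeros_ones)"
      using U by (auto simp: X1_space_def cantor_space_def openin_subtopology)
    obtain m where m: "cylinder ?A zeros m \<subseteq> W"
      using open_contains_cylinder[OF W(1), of zeros] z W(2) by blast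
    have "zeros_ones n \<in> U" if "n \<ge> m" for n
    proof -
      have "zeros_ones n \<in> cylinder ?A zeros m"
        using inA(2) that unfolding cylinder_def by (auto simp: zeros_def zeros_ones_def)
      with m W(2) show ?thesis by auto
    qed
    then show "\<exists>m. \<forall>n\<ge>m. zeros_ones n \<in> U" by blast
  next
    assume U: "U \<subseteq> topspace X1_space \<and> (zeros \<in> U \<longrightarrow> (\<exists>m. \<forall>n\<ge>m. zeros_ones n \<in> U))"
    show "openin X1_space U"
    proof (subst openin_subopen, intro ballI)
      fix x assume x: "x \<in> U"
      then have "x \<in> topspace X1_space" using U by blast
      then show "\<exists>T. openin X1_space T \<and> x \<in> T \<and> T \<subseteq> U"
      proof (cases rule: X1_cases)
        case 1
        then obtain m where m: "\<forall>n\<ge>m. zeros_ones n \<in> U" using U x by auto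
        have "cylinder ?A zeros m \<inter> topspace X1_space \<subseteq> U"
        proof
          fix y assume y: "y \<in> cylinder ?A zeros m \<inter> topspace X1_space"
          then have "y \<in> topspace X1_space" by simp
          then show "y \<in> U"
          proof (cases rule: X1_cases)
            case (2 n)
            have "\<not> n < m" using y 2 by (auto simp: cylinder_def zeros_def zeros_ones_def)
            with m 2 show ?thesis by auto
          qed (use 1 x in simp)
        qed
        moreover have "x \<in> cylinder ?A zeros m \<inter> topspace X1_space"
          using inA(1) 1 unfolding cylinder_def by (simp add: topspace_X1_space del: topspace_product_topology)
        ultimately show ?thesis using cyl by blast
      next
        case (2 k)
        have "cylinder ?A x (Suc k) \<inter> topspace X1_space \<subseteq> {x}"
        proof
          fix y assume y: "y \<in> cylinder ?A x (Suc k) \<inter> topspace X1_space"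
          then have yk: "y i = x i" if "i \<le> k" for i using that by (simp add: cylinder_def less_Suc_eq_le)
          from y have "y \<in> topspace X1_space" by simp
          then show "y \<in> {x}"
          proof (cases rule: X1_cases)
            case 1
            then show ?thesis using yk[of k] 2 by (simp add: zeros_def zeros_ones_def)
          next
            case (2 n)
            have "\<not> k < n" using yk[of k] 2 \<open>x = zeros_ones k\<close> by (auto simp: zeros_ones_def)
            moreover have "\<not> n < k" using yk[of n] 2 \<open>x = zeros_ones k\<close> by (auto simp: zeros_ones_def)
            ultimately show ?thesis using 2 \<open>x = zeros_ones k\<close> by simp
          qed
        qed
        moreover have "x \<in> cylinder ?A x (Suc k) \<inter> topspace X1_space"
          using inA(2) 2 unfolding cylinder_def by (simp add: topspace_X1_space del: topspace_product_topology)
        ultimately show ?thesis using cyl x by blast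
      qed
    qed
  qed
qed

text \<open>A function on \<open>X1_space\<close> given by its value at the limit and its values along the sequence; the
  unique choice of the index inverts \<open>zeros_ones\<close>.\<close>
definition sequence_map :: "'a \<Rightarrow> (nat \<Rightarrow> 'a) \<Rightarrow> (nat \<Rightarrow> nat) \<Rightarrow> 'a" where
  "sequence_map a s x = (if x = zeros then a else s (THE n. x = zeros_ones n))"

lemma sequence_map_simps [simp]:
  "sequence_map a s zeros = a" "sequence_map a s (zeros_ones n) = s n"
  by (simp_all add: sequence_map_def zeros_ones_neq_zeros zeros_ones_inject)

lemma continuous_map_sequence_map:
  assumes "a \<in> topspace Y" "\<And>n. s n \<in> topspace Y"
    and "\<And>V. openin Y V \<Longrightarrow> a \<in> V \<Longrightarrow> \<exists>m. \<forall>n\<ge>m. s n \<in> V"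
  shows "continuous_map X1_space Y (sequence_map a s)"
  using assms by (auto simp: continuous_map_def openin_X1_space topspace_X1_space)

abbreviation permutation_map :: "(nat \<Rightarrow> nat) \<Rightarrow> (nat \<Rightarrow> nat) \<Rightarrow> nat \<Rightarrow> nat" where
  "permutation_map \<sigma> \<equiv> sequence_map zeros (\<lambda>n. zeros_ones (\<sigma> n))"

definition permutation_graph :: "(nat \<Rightarrow> nat) \<Rightarrow> (nat \<Rightarrow> nat) tgraph" where
  "permutation_graph \<sigma> = (X1_space, induced_graph (topspace X1_space) (permutation_map \<sigma>))"

text \<open>An injection of the natural numbers takes each value below \<open>m\<close> only finitely often, hence tends to infinity,
  and so moving the isolated points along it is continuous at the limit.\<close>
lemma continuous_permutation_map:
  assumes "inj \<sigma>"
  shows "continuous_map X1_space X1_space (permutation_map \<sigma>)"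
proof (rule continuous_map_sequence_map)
  fix V assume "openin X1_space V" "zeros \<in> V"
  then obtain m where m: "\<forall>n\<ge>m. zeros_ones n \<in> V" by (auto simp: openin_X1_space)
  have "finite {n. \<sigma> n < m}"
    using finite_vimageI[OF finite_lessThan assms, of m] by (simp add: vimage_def)
  then obtain k where "\<And>n. \<sigma> n < m \<Longrightarrow> n < k"
    by (auto simp: finite_nat_set_iff_bounded)
  with m show "\<exists>k. \<forall>n\<ge>k. zeros_ones (\<sigma> n) \<in> V"
    by (meson not_le)
qed (auto simp: topspace_X1_space)

lemma homeomorphic_permutation_map:
  assumes "bij \<sigma>"
  shows "homeomorphic_map X1_space X1_space (permutation_map \<sigma>)"
proof -
  have "homeomorphic_maps X1_space X1_space (permutation_map \<sigma>) (permutation_map (inv \<sigma>))"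
    unfolding homeomorphic_maps_def
    using assms by (auto simp: topspace_X1_space bij_is_inj bij_is_surj bij_imp_bij_inv surj_f_inv_f
        intro!: continuous_permutation_map)
  then show ?thesis
    using homeomorphic_maps_map by blast
qed

lemma permutation_graph_edge:
  "(x, y) \<in> snd (permutation_graph \<sigma>) \<longleftrightarrow>
     (\<exists>m n. x = zeros_ones m \<and> y = zeros_ones n \<and> m \<noteq> n \<and> (n = \<sigma> m \<or> m = \<sigma> n))"
  by (auto simp: permutation_graph_def mem_induced_graph topspace_X1_space zeros_ones_inject)

text \<open>A continuous colouring is constant near the limit. As \<open>\<sigma>\<close> moves infinitely many points, and maps only
  finitely many of them far away from the limit, some edge has both its end points in this region.\<close>
lemma permutation_graph_in_GG:
  assumes "bij \<sigma>" "infinite {n. \<sigma> n \<noteq> n}"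
  shows "permutation_graph \<sigma> \<in> GG k"
proof -
  have "\<not> continuously_colorable (permutation_graph \<sigma>) (enat k)"
  proof
    assume "continuously_colorable (permutation_graph \<sigma>) (enat k)"
    then obtain c where c: "continuous_map X1_space (discrete_topology {i. enat i < enat k}) c"
      "coloring (snd (permutation_graph \<sigma>)) c"
      by (auto simp: continuously_colorable_def permutation_graph_def)
    have "openin X1_space {x \<in> topspace X1_space. c x = c zeros}"
      using openin_preimage_discrete_map[OF c(1), of "\<lambda>i. i = c zeros"] by simp
    moreover have "zeros \<in> {x \<in> topspace X1_space. c x = c zeros}"
      by (simp add: topspace_X1_space)
    ultimately obtain m where "\<forall>n\<ge>m. zeros_ones n \<in> {x \<in> topspace X1_space. c x = c zeros}"
      unfolding openin_X1_space by blast
    then have m: "c (zeros_ones n) = c zeros" if "n \<ge> m" for n using that by blast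
    have "finite ({n. \<sigma> n < m} \<union> {..<m})"
      using finite_vimageI[OF finite_lessThan bij_is_inj[OF assms(1)], of m] by (simp add: vimage_def)
    then obtain n where "\<sigma> n \<noteq> n" "n \<notin> {n. \<sigma> n < m} \<union> {..<m}"
      using infinite_imp_nonempty[OF Diff_infinite_finite[OF _ assms(2)], of "{n. \<sigma> n < m} \<union> {..<m}"]
      by blast
    then have "(zeros_ones n, zeros_ones (\<sigma> n)) \<in> snd (permutation_graph \<sigma>)"
      and "c (zeros_ones n) = c (zeros_ones (\<sigma> n))"
      using m by (auto simp: permutation_graph_edge zeros_ones_inject)
    with c(2) show False by (auto simp: coloring_def)
  qed
  then show ?thesis
    unfolding GG_iff using zdmc_X1_space homeomorphic_permutation_map[OF assms(1)]
    by (auto simp: permutation_graph_def)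
qed

text \<open>The permutation of the indices that \<open>f1\<close> induces.\<close>
definition swap_pairs :: "nat \<Rightarrow> nat" where
  "swap_pairs n = (if even n then Suc n else n - 1)"

lemma X1_graph_eq: "X1_graph = permutation_graph swap_pairs"
proof -
  have "f1 x = permutation_map swap_pairs x" if "x \<in> topspace X1_space" for x
    using that
  proof (cases rule: X1_cases)
    case (2 n)
    have "n = 2 * (n div 2) + n mod 2" "n mod 2 \<in> {0, 1}" by auto
    moreover have "2 * (n div 2) + 1 - n mod 2 = swap_pairs n"
      by (cases "even n") (auto simp: swap_pairs_def elim!: evenE oddE)
    ultimately show ?thesis
      using f1_zeros_ones[of "n mod 2" "n div 2"] 2 by simp
  qed (simp add: f1_zeros)
  then show ?thesis
    by (auto simp: X1_graph_def permutation_graph_def mem_induced_graph)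
qed

lemma swap_pairs: "bij swap_pairs" "swap_pairs n \<noteq> n"
proof -
  have "swap_pairs (swap_pairs n) = n" for n
    by (auto simp: swap_pairs_def elim: oddE)
  then show "bij swap_pairs" using involuntory_imp_bij by blast
  show "swap_pairs n \<noteq> n" by (cases n) (auto simp: swap_pairs_def)
qed

lemma X1_graph_in_GG: "X1_graph \<in> GG k"
  unfolding X1_graph_eq
  by (rule permutation_graph_in_GG) (simp_all add: swap_pairs)

section \<open>The dichotomy for three colours\<close>

definition third_colour :: "nat \<Rightarrow> nat \<Rightarrow> nat" where
  "third_colour a b = (if 0 \<notin> {a, b} then 0 else if 1 \<notin> {a, b} then 1 else 2)"

lemma third_colour: "third_colour a b \<noteq> a" "third_colour a b \<noteq> b" "third_colour a b < 3"
  by (auto simp: third_colour_def)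

text \<open>The greedy argument: finitely many clopen sets without inner edges cover the space, and the partial
  colouring is extended over one of them at a time. A new point only has to avoid the colours
  of its image and of its preimage, so that one of three colours is always free; no edge joins two new points.\<close>
lemma three_colorable:
  assumes X: "compact_space X" and f: "homeomorphic_map X X f"
    and loc: "\<And>x. x \<in> topspace X \<Longrightarrow>
      \<exists>U. openin X U \<and> closedin X U \<and> x \<in> U \<and> (\<forall>y\<in>U. f y \<in> U \<longrightarrow> f y = y)"
  shows "continuously_colorable (X, induced_graph (topspace X) f) (enat 3)"
proof -
  obtain g where g: "homeomorphic_maps X X f g"
    using f homeomorphic_map_maps by blast
  let ?D = "discrete_topology {i. enat i < enat 3}"
  define good where "good U \<longleftrightarrow> openin X U \<and> closedin X U \<and> (\<forall>y\<in>U. f y \<in> U \<longrightarrow> f y = y)" for U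
  have ext: "\<exists>c. continuous_map X ?D c \<and>
      (\<forall>x\<in>\<Union>\<F>. f x \<in> \<Union>\<F> \<longrightarrow> f x \<noteq> x \<longrightarrow> c x \<noteq> c (f x))"
    if "finite \<F>" "\<F> \<subseteq> Collect good" for \<F>
    using that
  proof (induction)
    case empty
    show ?case by (intro exI[of _ "\<lambda>_. 0"] conjI) simp_all
  next
    case (insert U \<F>)
    have "\<exists>c. continuous_map X ?D c \<and>
        (\<forall>x\<in>\<Union>\<F>. f x \<in> \<Union>\<F> \<longrightarrow> f x \<noteq> x \<longrightarrow> c x \<noteq> c (f x))"
      by (rule insert.IH) (use insert.prems in simp)
    then obtain c where c: "continuous_map X ?D c"
      "\<forall>x\<in>\<Union>\<F>. f x \<in> \<Union>\<F> \<longrightarrow> f x \<noteq> x \<longrightarrow> c x \<noteq> c (f x)"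
      by (elim exE conjE)
    define V where "V = \<Union>\<F>"
    have V: "openin X V" "closedin X V"
      using insert unfolding V_def good_def by (auto intro!: closedin_Union openin_Union)
    have U: "openin X U" "closedin X U" "\<And>y. y \<in> U \<Longrightarrow> f y \<in> U \<Longrightarrow> f y = y"
      using insert.prems by (auto simp: good_def)
    have sub: "U \<subseteq> topspace X" "V \<subseteq> topspace X" using U V openin_subset by blast+
\<comment> \<open>The colours of points outside \<open>V\<close> are avoided as well: this does no harm, and it makes
      the extension a function of three continuous maps, hence continuous.\<close>
    define c' where "c' x = (if x \<in> V then c x else third_colour (c (f x)) (c (g x)))" for x
    have cf: "continuous_map X ?D (c \<circ> f)" "continuous_map X ?D (c \<circ> g)"
      using c(1) g by (auto simp: homeomorphic_maps_def intro: continuous_map_compose)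
    have op: "openin X {x \<in> topspace X. c' x = i}" for i
    proof -
      have "{x \<in> topspace X. c' x = i} = V \<inter> {x \<in> topspace X. c x = i} \<union>
         (topspace X - V) \<inter> (\<Union>(a, b)\<in>{(a, b). third_colour a b = i}.
            {x \<in> topspace X. (c \<circ> f) x = a} \<inter> {x \<in> topspace X. (c \<circ> g) x = b})"
        by (auto simp: c'_def)
      moreover have "openin X {x \<in> topspace X. c x = i}"
        using openin_preimage_discrete_map[OF c(1), of "\<lambda>j. j = i"] .
      moreover have "openin X (\<Union>(a, b)\<in>{(a, b). third_colour a b = i}.
            {x \<in> topspace X. (c \<circ> f) x = a} \<inter> {x \<in> topspace X. (c \<circ> g) x = b})"
        using openin_preimage_discrete_map[OF cf(1), of "\<lambda>j. j = _"]
          openin_preimage_discrete_map[OF cf(2), of "\<lambda>j. j = _"]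
        by (auto intro!: openin_Union openin_Int)
      moreover have "openin X (topspace X - V)" using V by blast
      ultimately show ?thesis
        using V(1) by (simp only: openin_Un openin_Int)
    qed
    have "continuous_map X ?D c'"
      unfolding continuous_map_into_discrete
      using c(1) op by (auto simp: c'_def third_colour continuous_map_def)
    moreover have "c' x \<noteq> c' (f x)" if x: "x \<in> V \<union> U" "f x \<in> V \<union> U" "f x \<noteq> x" for x
    proof -
      have "g (f x) = x"
        using g x(1) sub by (auto simp: homeomorphic_maps_def)
      then show ?thesis
        using x U(3)[of x] c(2)[rule_format, of x] third_colour[of "c (f x)" "c (g x)"]
          third_colour[of "c (f (f x))" "c (g (f x))"]
        unfolding V_def[symmetric] by (auto simp: c'_def)
    qed
    ultimately show ?case
      by (intro exI[of _ c']) (auto simp: V_def)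
  qed
  have "\<forall>U\<in>Collect good. openin X U" by (simp add: good_def)
  moreover have "topspace X \<subseteq> \<Union>(Collect good)"
    using loc unfolding good_def by fastforce
  ultimately obtain \<F> where F: "finite \<F>" "\<F> \<subseteq> Collect good" "topspace X \<subseteq> \<Union>\<F>"
    using X[unfolded compact_space_alt, rule_format, of "Collect good"] by blast
  obtain c where c: "continuous_map X ?D c"
      "\<forall>x\<in>\<Union>\<F>. f x \<in> \<Union>\<F> \<longrightarrow> f x \<noteq> x \<longrightarrow> c x \<noteq> c (f x)"
    using ext[OF F(1,2)] by (elim exE conjE)
  have "c x \<noteq> c (f x)" if "x \<in> topspace X" "f x \<noteq> x" for x
  proof -
    have "f x \<in> topspace X"
      using that(1) g by (auto simp: homeomorphic_maps_def continuous_map_def)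
    then show ?thesis
      using c(2) F(3) that by (meson subsetD)
  qed
  then have "coloring (induced_graph (topspace X) f) c"
    by (force simp: coloring_def mem_induced_graph)
  with c(1) show ?thesis
    by (auto simp: continuously_colorable_def)
qed

text \<open>Without a continuous 3-colouring, some point \<open>x\<close> has edges inside all of its neighbourhoods. If \<open>f\<close> moved
  \<open>x\<close>, it would map a small neighbourhood of \<open>x\<close> off itself; hence \<open>x\<close> is fixed.\<close>
lemma fixed_limit_of_moved_points:
  assumes X: "zdmc_space X" and f: "homeomorphic_map X X f"
    and nc: "\<not> continuously_colorable (X, induced_graph (topspace X) f) (enat 3)"
  obtains x where "x \<in> topspace X" "f x = x"
    "\<And>U. openin X U \<Longrightarrow> x \<in> U \<Longrightarrow> \<exists>y\<in>U. f y \<in> U \<and> f y \<noteq> y"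
proof -
  obtain x where x: "x \<in> topspace X"
    "\<And>U. openin X U \<Longrightarrow> closedin X U \<Longrightarrow> x \<in> U \<Longrightarrow> \<exists>y\<in>U. f y \<in> U \<and> f y \<noteq> y"
    using three_colorable[OF zdmc_compact[OF X] f] nc by metis
  have lim: "\<exists>y\<in>U. f y \<in> U \<and> f y \<noteq> y" if U: "openin X U" "x \<in> U" for U
  proof -
    obtain V where "openin X V" "closedin X V" "x \<in> V" "V \<subseteq> U"
      by (rule zdmc_clopen_nbhd[OF X U])
    with x(2)[of V] show ?thesis by blast
  qed
  have cont: "continuous_map X X f"
    using f homeomorphic_imp_continuous_map by blast
  have "f x = x"
  proof (rule ccontr)
    assume "f x \<noteq> x"
    moreover have "f x \<in> topspace X" using cont x(1) by (auto simp: continuous_map_def)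
    ultimately obtain A B where AB: "openin X A" "openin X B" "x \<in> A" "f x \<in> B" "disjnt A B"
      using zdmc_Hausdorff[OF X] x(1) unfolding Hausdorff_space_def by metis
    have "openin X (A \<inter> {y \<in> topspace X. f y \<in> B})"
      using AB openin_continuous_map_preimage[OF cont] by blast
    from lim[OF this] AB x(1) show False by (auto simp: disjnt_iff)
  qed
  with x(1) lim that show ?thesis by blast
qed

text \<open>Moved points \<open>y\<close> such that \<open>y\<close> and \<open>f y\<close> are both close to the fixed point \<open>x\<close> form pairs converging
  to \<open>x\<close>. Sending the pairs of \<open>f1\<close> to such pairs, and \<open>zeros\<close> to \<open>x\<close>, is the desired reduction.\<close>
lemma X1_graph_minimum:
  assumes "G \<in> GG 3"
  shows "X1_graph \<preceq>\<^sup>i\<^sub>c G"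
proof -
  obtain X f where G: "G = (X, induced_graph (topspace X) f)" and X: "zdmc_space X"
    and f: "homeomorphic_map X X f"
    and nc: "\<not> continuously_colorable (X, induced_graph (topspace X) f) (enat 3)"
    using assms by (auto simp: GG_iff)
  obtain x where x: "x \<in> topspace X" "f x = x"
    "\<And>U. openin X U \<Longrightarrow> x \<in> U \<Longrightarrow> \<exists>y\<in>U. f y \<in> U \<and> f y \<noteq> y"
    using fixed_limit_of_moved_points[OF X f nc] by blast
  have inj: "inj_on f (topspace X)" and fX: "\<And>y. y \<in> topspace X \<Longrightarrow> f y \<in> topspace X"
    using f homeomorphic_imp_injective_map homeomorphic_imp_surjective_map by blast+
  obtain M d where M: "Metric_space M d" "X = Metric_space.mtopology M d"
    using X by (auto simp: zdmc_space_def metrizable_space_def)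
  interpret Metric_space M d by (rule M(1))
  have MX: "topspace X = M" using M(2) by simp
  define moved where "moved y \<longleftrightarrow> y \<in> M \<and> f y \<in> M \<and> f y \<noteq> y" for y
  have near: "\<exists>y. moved y \<and> d x y < e \<and> d x (f y) < e" if "e > 0" for e
    using x(3)[of "mball x e"] that x(1) MX M(2) by (auto simp: moved_def)
  have pos: "d x y > 0" "d x (f y) > 0" if "moved y" for y
  proof -
    have "y \<noteq> x" using that x(2) by (auto simp: moved_def)
    moreover have "f y \<noteq> x"
      using that x(1,2) inj MX \<open>y \<noteq> x\<close> by (metis inj_onD moved_def)
    ultimately show "d x y > 0" "d x (f y) > 0"
      using that x(1) MX by (auto simp: moved_def)
  qed
\<comment> \<open>Each pair is chosen strictly closer to the fixed point than both members of the previous one,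
    which makes the pairs disjoint.\<close>
  define Q where "Q y z \<longleftrightarrow> max (d x z) (d x (f z)) < min (d x y) (d x (f y))" for y z
  have "\<exists>y. \<forall>n. (moved (y n) \<and> d x (y n) < 1 / Suc n \<and> d x (f (y n)) < 1 / Suc n) \<and> Q (y n) (y (Suc n))"
  proof (rule dependent_nat_choice)
    show "\<exists>y. moved y \<and> d x y < 1 / Suc 0 \<and> d x (f y) < 1 / Suc 0"
      using near[of 1] by simp
    fix y n assume y: "moved y \<and> d x y < 1 / Suc n \<and> d x (f y) < 1 / Suc n"
    define e where "e = min (min (d x y) (d x (f y))) (1 / Suc (Suc n))"
    have "e > 0" using pos y by (simp add: e_def)
    from near[OF this] show "\<exists>z. (moved z \<and> d x z < 1 / Suc (Suc n) \<and> d x (f z) < 1 / Suc (Suc n)) \<and> Q y z"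
      by (auto simp: e_def Q_def)
  qed
  then obtain y where y: "\<And>n. moved (y n)" "\<And>n. d x (y n) < 1 / Suc n" "\<And>n. d x (f (y n)) < 1 / Suc n"
    "\<And>n. Q (y n) (y (Suc n))" by blast
  have Q: "Q (y m) (y n)" if "m < n" for m n
    using that
  proof (induction rule: less_Suc_induct)
    case (1 i)
    then show ?case by (rule y(4))
  next
    case (2 i j k)
    then show ?case by (auto simp: Q_def)
  qed
  define s where "s m = (if even m then y (m div 2) else f (y (m div 2)))" for m
  have s_inj: "m = n" if "s m = s n" for m n
  proof -
    have "m div 2 = n div 2"
    proof (rule ccontr)
      assume "m div 2 \<noteq> n div 2"
      then have "Q (y (m div 2)) (y (n div 2)) \<or> Q (y (n div 2)) (y (m div 2))"
        using Q by (metis linorder_neqE_nat)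
      then show False using that by (auto simp: Q_def s_def split: if_splits)
    qed
    moreover have "even m \<longleftrightarrow> even n"
      using that y(1)[of "n div 2"] calculation by (auto simp: s_def moved_def split: if_splits)
    ultimately show "m = n"
      by (metis even_two_times_div_two odd_two_times_div_two_succ)
  qed
  have s_top: "s n \<in> topspace X" "s n \<noteq> x" for n
    using y(1)[of "n div 2"] pos[OF y(1)[of "n div 2"]] mdist_zero[of x] x(1) MX
    by (auto simp: s_def MX moved_def)
  have s_lim: "\<exists>m. \<forall>n\<ge>m. s n \<in> V" if V: "openin X V" "x \<in> V" for V
  proof -
    obtain r where r: "r > 0" "mball x r \<subseteq> V"
      using V M(2) by (auto simp: openin_mtopology)
    obtain m where m: "inverse (real (Suc m)) < r" using reals_Archimedean[OF r(1)] by blast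
    have "s n \<in> V" if "n \<ge> 2 * m" for n
    proof -
      have "1 / real (Suc (n div 2)) \<le> 1 / real (Suc m)"
        using that by (intro divide_left_mono) auto
      then have "d x (s n) < r"
        using m y(2)[of "n div 2"] y(3)[of "n div 2"] by (simp add: s_def inverse_eq_divide)
      then have "s n \<in> mball x r" using s_top[of n] x(1) MX by auto
      with r show ?thesis by blast
    qed
    then show ?thesis by blast
  qed
  have "continuous_map X1_space X (sequence_map x s)"
    by (rule continuous_map_sequence_map) (use x s_top s_lim in auto)
  moreover have "inj_on (sequence_map x s) (topspace X1_space)"
    using s_inj s_top(2) by (auto simp: topspace_X1_space intro!: inj_onI) metis+
  moreover have "(sequence_map x s u, sequence_map x s v) \<in> snd G" if "(u, v) \<in> snd X1_graph" for u v
  proof -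
    have edge: "(s m, s (swap_pairs m)) \<in> snd G" "(s (swap_pairs m), s m) \<in> snd G" for m
      using y(1)[of "m div 2"] MX
      by (auto simp: G mem_induced_graph s_def swap_pairs_def moved_def elim!: oddE)
    from that obtain m n where "u = zeros_ones m" "v = zeros_ones n" "n = swap_pairs m \<or> m = swap_pairs n"
      unfolding X1_graph_eq permutation_graph_edge by blast
    then show ?thesis using edge by auto
  qed
  ultimately show ?thesis
    unfolding reducible_ic_def by (auto simp: X1_graph_def G intro!: exI[of _ "sequence_map x s"])
qed

section \<open>Closed walks of odd length\<close>

text \<open>The displacement of a walk of odd length is odd, in particular it is not zero. Both for cycles and for odometers
  this is the reason why few reductions exist.\<close>
lemma sum_of_signs:
  fixes s :: "nat \<Rightarrow> int"
  assumes "\<And>i. s i = 1 \<or> s i = -1"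
  shows "even (sum s {..<n}) \<longleftrightarrow> even n" "\<bar>sum s {..<n}\<bar> \<le> int n"
proof -
  have "(even (sum s {..<n}) \<longleftrightarrow> even n) \<and> \<bar>sum s {..<n}\<bar> \<le> int n"
  proof (induction n)
    case (Suc n)
    then show ?case using assms[of n] by auto
  qed simp
  then show "even (sum s {..<n}) \<longleftrightarrow> even n" "\<bar>sum s {..<n}\<bar> \<le> int n" by auto
qed

text \<open>The natural numbers are split into consecutive intervals, the one starting at \<open>k\<^sup>2\<close> having
  \<open>2 * k + 1\<close> elements.\<close>
definition block :: "nat \<Rightarrow> nat \<Rightarrow> nat" where
  "block k i = k\<^sup>2 + i"

lemma block_cases:
  obtains k i where "n = block k i" "i < 2 * k + 1"
proof -
  have "(floor_sqrt n)\<^sup>2 \<le> n" by simp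
  moreover have "n < (Suc (floor_sqrt n))\<^sup>2" by (rule Suc_floor_sqrt_power2_gt)
  ultimately show ?thesis
    using that[of "floor_sqrt n" "n - (floor_sqrt n)\<^sup>2"] by (simp add: block_def power2_eq_square)
qed

lemma block_eq_iff:
  assumes "i < 2 * k + 1" "j < 2 * l + 1"
  shows "block k i = block l j \<longleftrightarrow> k = l \<and> i = j"
proof
  have "floor_sqrt (block k i) = k" "floor_sqrt (block l j) = l"
    using assms by (auto intro!: floor_sqrt_unique simp: block_def power2_eq_square)
  then show "block k i = block l j \<Longrightarrow> k = l \<and> i = j"
    by (metis add_left_cancel block_def)
qed simp

text \<open>Rotation of the blocks with index in \<open>S\<close> by \<open>a\<close> places; integer \<open>a\<close> makes the inverse an
  instance of the same definition.\<close>
definition rotate_blocks :: "nat set \<Rightarrow> int \<Rightarrow> nat \<Rightarrow> nat" where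
  "rotate_blocks S a n = (THE m. \<exists>k i. n = block k i \<and> i < 2 * k + 1 \<and>
     m = (if k \<in> S then block k (nat ((int i + a) mod (2 * int k + 1))) else n))"

lemma rotate_blocks:
  assumes "i < 2 * k + 1"
  shows "rotate_blocks S a (block k i) =
    (if k \<in> S then block k (nat ((int i + a) mod (2 * int k + 1))) else block k i)"
  unfolding rotate_blocks_def using assms by (intro the_equality) (auto simp: block_eq_iff)

lemma rotate_blocks_index: "nat (x mod (2 * int k + 1)) < 2 * k + 1"
proof -
  have "0 \<le> x mod (2 * int k + 1)" "x mod (2 * int k + 1) < 2 * int k + 1"
    using pos_mod_bound[of "2 * int k + 1" x] by simp_all
  then show ?thesis by linarith
qed

lemma rotate_blocks_inverse: "a + b = 0 \<Longrightarrow> rotate_blocks S a (rotate_blocks S b n) = n"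
proof -
  assume ab: "a + b = 0"
  obtain k i where n: "n = block k i" "i < 2 * k + 1" by (rule block_cases)
  have "((int i + b) mod (2 * int k + 1) + a) mod (2 * int k + 1) = (int i + (a + b)) mod (2 * int k + 1)"
    by (simp add: mod_simps algebra_simps)
  also have "\<dots> = int i" using ab n(2) by simp
  finally show ?thesis
    using n rotate_blocks_index[of "int i + b" k] by (simp add: rotate_blocks)
qed

lemma bij_rotate_blocks: "bij (rotate_blocks S a)"
  by (rule o_bij[of "rotate_blocks S (- a)"]) (auto simp: rotate_blocks_inverse)

text \<open>Isolated vertices and disjoint cycles, of length \<open>2 * k + 1\<close> for the non-zero \<open>k \<in> S\<close>, accumulating at
  a fixed point if \<open>S\<close> is infinite.\<close>
definition cycles_graph :: "nat set \<Rightarrow> (nat \<Rightarrow> nat) tgraph" where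
  "cycles_graph S = permutation_graph (rotate_blocks S 1)"

lemma rotate_blocks_moves:
  assumes "k \<in> S" "0 < k" "i < 2 * k + 1"
  shows "rotate_blocks S 1 (block k i) \<noteq> block k i"
proof
  assume "rotate_blocks S 1 (block k i) = block k i"
  then have "nat ((int i + 1) mod (2 * int k + 1)) = i"
    using assms rotate_blocks[OF assms(3), of S 1] by (simp add: block_def)
  moreover have "0 \<le> (int i + 1) mod (2 * int k + 1)" by simp
  ultimately have "(int i + 1) mod (2 * int k + 1) = int i" by linarith
  then have "(int i + 1) mod (2 * int k + 1) = int i mod (2 * int k + 1)"
    using assms(3) by simp
  then have "2 * int k + 1 dvd 1" by (simp add: mod_eq_dvd_iff)
  then show False using assms by (auto dest: zdvd_imp_le)
qed

lemma cycles_graph_in_GG: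
  assumes "infinite S" "0 \<notin> S"
  shows "cycles_graph S \<in> GG k"
  unfolding cycles_graph_def
proof (rule permutation_graph_in_GG[OF bij_rotate_blocks])
  have "(\<lambda>k. block k 0) ` S \<subseteq> {n. rotate_blocks S 1 n \<noteq> n}"
    using rotate_blocks_moves[of _ S 0] assms(2) by (auto intro!: gr0I)
  moreover have "infinite ((\<lambda>k. block k 0) ` S)"
    using assms(1) by (subst finite_image_iff) (auto simp: inj_on_def block_def)
  ultimately show "infinite {n. rotate_blocks S 1 n \<noteq> n}"
    using finite_subset by blast
qed

text \<open>The identity is a reduction, since enlarging \<open>S\<close> only adds edges on the same space.\<close>
lemma cycles_graph_mono:
  assumes "S \<subseteq> T"
  shows "cycles_graph S \<preceq>\<^sup>i\<^sub>c cycles_graph T"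
proof -
  have "rotate_blocks T 1 n = rotate_blocks S 1 n" if "rotate_blocks S 1 n \<noteq> n" for n
  proof -
    obtain k i where n: "n = block k i" "i < 2 * k + 1" by (rule block_cases)
    show ?thesis using that assms n by (auto simp: rotate_blocks split: if_splits)
  qed
  then have "snd (cycles_graph S) \<subseteq> snd (cycles_graph T)"
    unfolding cycles_graph_def by (auto simp: permutation_graph_edge) metis+
  then show ?thesis
    unfolding reducible_ic_def
    by (intro exI[of _ id]) (auto simp: cycles_graph_def permutation_graph_def)
qed

text \<open>The image of the \<open>k\<close>-th cycle is a closed walk of length \<open>2 * k + 1\<close> around a single cycle. Its displacement
  is odd, hence not zero, and a multiple of the length \<open>2 * j + 1\<close> of that cycle, which gives \<open>j \<le> k\<close>.\<close>
lemma cycle_image: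
  assumes hom: "\<And>x y. (x, y) \<in> snd (cycles_graph S) \<Longrightarrow> (\<phi> x, \<phi> y) \<in> snd (cycles_graph T)"
    and k: "k \<in> S" "0 < k"
  obtains j r where "j \<in> T" "j \<le> k"
    "\<And>i. i < 2 * k + 1 \<Longrightarrow> \<phi> (zeros_ones (block k i)) = zeros_ones (block j (r i)) \<and> r i < 2 * j + 1"
proof -
  define v where "v i = block k (i mod (2 * k + 1))" for i
  have v_next: "v (Suc i) = rotate_blocks S 1 (v i)" for i
  proof -
    have "int (Suc i mod (2 * k + 1)) = (int (i mod (2 * k + 1)) + 1) mod (2 * int k + 1)"
      by (simp add: zmod_int mod_simps algebra_simps)
    then have "Suc i mod (2 * k + 1) = nat ((int (i mod (2 * k + 1)) + 1) mod (2 * int k + 1))"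
      by (metis nat_int)
    then show ?thesis using k by (simp add: v_def rotate_blocks)
  qed
  have v_edge: "(zeros_ones (v i), zeros_ones (v (Suc i))) \<in> snd (cycles_graph S)" for i
    using rotate_blocks_moves[OF k, of "i mod (2 * k + 1)"]
    unfolding cycles_graph_def permutation_graph_edge v_next by (auto simp: v_def zeros_ones_inject)
  have "\<exists>m n. \<phi> (zeros_ones (v i)) = zeros_ones m \<and> \<phi> (zeros_ones (v (Suc i))) = zeros_ones n \<and>
      m \<noteq> n \<and> (n = rotate_blocks T 1 m \<or> m = rotate_blocks T 1 n)" for i
    using hom[OF v_edge[of i]] unfolding cycles_graph_def permutation_graph_edge .
  then obtain w where w: "\<And>i. \<phi> (zeros_ones (v i)) = zeros_ones (w i)"
    by metis
  have step: "w i \<noteq> w (Suc i) \<and> (w (Suc i) = rotate_blocks T 1 (w i) \<or> w i = rotate_blocks T 1 (w (Suc i)))" for i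
    using hom[OF v_edge[of i]] unfolding cycles_graph_def permutation_graph_edge w zeros_ones_inject
    by blast
  have "\<exists>j r. w i = block j r \<and> r < 2 * j + 1" for i
    using block_cases by metis
  then obtain J r where Jr: "\<And>i. w i = block (J i) (r i)" "\<And>i. r i < 2 * J i + 1"
    by metis
  have stepJ: "J (Suc i) = J i \<and> J i \<in> T \<and>
      (\<exists>s. (s = 1 \<or> s = -1) \<and> int (r (Suc i)) = (int (r i) + s) mod (2 * int (J i) + 1))" for i
  proof -
    consider "w (Suc i) = rotate_blocks T 1 (w i)" | "w i = rotate_blocks T 1 (w (Suc i))"
      using step by blast
    then show ?thesis
    proof cases
      case 1
      then have "J i \<in> T" using step[of i] Jr by (auto simp: rotate_blocks split: if_splits)
      with 1 have "block (J (Suc i)) (r (Suc i)) = block (J i) (nat ((int (r i) + 1) mod (2 * int (J i) + 1)))"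
        using Jr by (simp add: rotate_blocks)
      then have "J (Suc i) = J i" "r (Suc i) = nat ((int (r i) + 1) mod (2 * int (J i) + 1))"
        using block_eq_iff[OF Jr(2) rotate_blocks_index] by auto
      with \<open>J i \<in> T\<close> show ?thesis by (intro conjI exI[of _ 1]) auto
    next
      case 2
      then have "w (Suc i) = rotate_blocks T (-1) (w i)" by (simp add: rotate_blocks_inverse)
      moreover from this have "J i \<in> T" using step[of i] Jr by (auto simp: rotate_blocks split: if_splits)
      ultimately have "block (J (Suc i)) (r (Suc i)) = block (J i) (nat ((int (r i) + (-1)) mod (2 * int (J i) + 1)))"
        using Jr by (simp add: rotate_blocks)
      then have "J (Suc i) = J i" "r (Suc i) = nat ((int (r i) + (-1)) mod (2 * int (J i) + 1))"
        using block_eq_iff[OF Jr(2) rotate_blocks_index] by auto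
      with \<open>J i \<in> T\<close> show ?thesis by (intro conjI exI[of _ "-1"]) auto
    qed
  qed
  define j where "j = J 0"
  have J: "J i = j" for i
    by (induction i) (use stepJ in \<open>auto simp: j_def\<close>)
  have "j \<in> T" using stepJ[of 0] by (simp add: j_def)
  obtain s where s: "\<And>i. s i = 1 \<or> s i = -1" "\<And>i. int (r (Suc i)) = (int (r i) + s i) mod (2 * int j + 1)"
    using stepJ unfolding J by metis
  have "int (r n) mod (2 * int j + 1) = (int (r 0) + sum s {..<n}) mod (2 * int j + 1)" for n
  proof (induction n)
    case (Suc n)
    have "int (r (Suc n)) mod (2 * int j + 1) = (int (r n) mod (2 * int j + 1) + s n) mod (2 * int j + 1)"
      by (simp add: s(2) mod_simps)
    also have "\<dots> = ((int (r 0) + sum s {..<n}) mod (2 * int j + 1) + s n) mod (2 * int j + 1)"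
      by (simp only: Suc)
    also have "\<dots> = (int (r 0) + sum s {..<Suc n}) mod (2 * int j + 1)"
      by (simp add: mod_simps algebra_simps)
    finally show ?case .
  qed simp
  from this[of "2 * k + 1"] have "2 * int j + 1 dvd sum s {..<2 * k + 1}"
  proof -
    have "w (2 * k + 1) = w 0" using w[of 0] w[of "2 * k + 1"] by (simp add: v_def zeros_ones_inject)
    then have "r (2 * k + 1) = r 0" using Jr J by (simp add: block_def)
    then have "(int (r 0) + sum s {..<2 * k + 1}) mod (2 * int j + 1) = int (r 0) mod (2 * int j + 1)"
      using \<open>int (r (2 * k + 1)) mod (2 * int j + 1) = (int (r 0) + sum s {..<2 * k + 1}) mod (2 * int j + 1)\<close>
      by simp
    then show ?thesis by (simp only: mod_eq_dvd_iff add_diff_cancel_left')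
  qed
  moreover have "sum s {..<2 * k + 1} \<noteq> 0"
    using sum_of_signs(1)[of s "2 * k + 1", OF s(1)] by (metis dvd_0_right even_plus_one_iff even_mult_iff even_numeral)
  ultimately have "2 * int j + 1 \<le> \<bar>sum s {..<2 * k + 1}\<bar>"
    by (metis dvd_abs_iff zdvd_imp_le zero_less_abs_iff)
  then have "j \<le> k"
    using sum_of_signs(2)[of s "2 * k + 1", OF s(1)] by linarith
  show ?thesis
  proof (rule that[OF \<open>j \<in> T\<close> \<open>j \<le> k\<close>, of r])
    fix i assume "i < 2 * k + 1"
    then have "v i = block k i" by (simp add: v_def)
    then show "\<phi> (zeros_ones (block k i)) = zeros_ones (block j (r i)) \<and> r i < 2 * j + 1"
      using w[of i] Jr[of i] J[of i] by metis
  qed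
qed

lemma cycles_graph_reducible_c:
  assumes "cycles_graph S \<preceq>\<^sub>c cycles_graph T" "k \<in> S" "0 < k"
  obtains j where "j \<in> T" "j \<le> k"
proof -
  obtain \<phi> where "\<forall>(x, y)\<in>snd (cycles_graph S). (\<phi> x, \<phi> y) \<in> snd (cycles_graph T)"
    using assms(1) by (auto simp: reducible_c_def)
  then have hom: "(\<phi> x, \<phi> y) \<in> snd (cycles_graph T)" if "(x, y) \<in> snd (cycles_graph S)" for x y
    using that by blast
  show ?thesis
  proof (rule cycle_image[of S \<phi> T k])
    fix j r assume "j \<in> T" "j \<le> k"
    then show ?thesis by (rule that)
  qed (use hom assms in auto)
qed

text \<open>An injective image of a cycle also has room for all its points, so that \<open>j\<close> equals \<open>k\<close> above.\<close>
lemma cycles_graph_reducible_ic: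
  assumes "cycles_graph S \<preceq>\<^sup>i\<^sub>c cycles_graph T" "0 \<notin> S"
  shows "S \<subseteq> T"
proof
  fix k assume k: "k \<in> S"
  then have "0 < k" using assms(2) by (metis gr0I)
  obtain \<phi> where \<phi>: "\<forall>(x, y)\<in>snd (cycles_graph S). (\<phi> x, \<phi> y) \<in> snd (cycles_graph T)"
     "inj_on \<phi> (topspace X1_space)"
    using assms(1) by (auto simp: reducible_ic_def cycles_graph_def permutation_graph_def)
  obtain j r where j: "j \<in> T" "j \<le> k"
    and r: "\<And>i. i < 2 * k + 1 \<Longrightarrow> \<phi> (zeros_ones (block k i)) = zeros_ones (block j (r i)) \<and> r i < 2 * j + 1"
    using cycle_image[of S \<phi> T k] \<phi>(1) k \<open>0 < k\<close> by blast
  have "inj_on r {..<2 * k + 1}"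
  proof (rule inj_onI)
    fix a b assume "a \<in> {..<2 * k + 1}" "b \<in> {..<2 * k + 1}" "r a = r b"
    then have "\<phi> (zeros_ones (block k a)) = \<phi> (zeros_ones (block k b))"
      using r by auto
    then have "zeros_ones (block k a) = zeros_ones (block k b)"
      using \<phi>(2) by (auto simp: inj_on_def topspace_X1_space)
    then show "a = b" by (simp add: zeros_ones_inject block_def)
  qed
  moreover have "r ` {..<2 * k + 1} \<subseteq> {..<2 * j + 1}" using r by auto
  ultimately have "2 * k + 1 \<le> 2 * j + 1"
    using card_inj_on_le[of r "{..<2 * k + 1}" "{..<2 * j + 1}"] by simp
  with j(2) have "k = j" by simp
  with j(1) show "k \<in> T" by simp
qed


section \<open>Odometers with odd moduli\<close>

definition odometer_space :: "(nat \<Rightarrow> int) \<Rightarrow> (nat \<Rightarrow> int) topology" where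
  "odometer_space p = sequence_space (\<lambda>i. {0..<p i})"

text \<open>Addition of the constant \<open>k\<close> in the product of the groups of integers modulo \<open>p i\<close>. Allowing all integers
  \<open>k\<close> puts the odometer, its inverse and their iterates under one definition.\<close>
definition shift :: "(nat \<Rightarrow> int) \<Rightarrow> int \<Rightarrow> (nat \<Rightarrow> int) \<Rightarrow> nat \<Rightarrow> int" where
  "shift p k x = (\<lambda>i. (x i + k) mod p i)"

definition odometer_graph :: "(nat \<Rightarrow> int) \<Rightarrow> (nat \<Rightarrow> int) tgraph" where
  "odometer_graph p = (odometer_space p, induced_graph (topspace (odometer_space p)) (shift p 1))"

locale odd_moduli =
  fixes p :: "nat \<Rightarrow> int"
  assumes odd_p: "odd (p i)"
    and p_ge_3: "3 \<le> p i"
    and coprime_p: "i \<noteq> j \<Longrightarrow> coprime (p i) (p j)"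
begin

lemma p_pos: "0 < p i"
  using p_ge_3[of i] by linarith

lemma in_odometer: "x \<in> topspace (odometer_space p) \<longleftrightarrow> (\<forall>i. 0 \<le> x i \<and> x i < p i)"
  unfolding odometer_space_def topspace_sequence_space by simp

lemma zdmc_odometer: "zdmc_space (odometer_space p)"
  unfolding odometer_space_def by (rule zdmc_sequence_space) simp

lemma shift_in: "shift p k x \<in> topspace (odometer_space p)"
  using p_pos by (simp add: in_odometer shift_def)

lemma shift_shift: "shift p k (shift p l x) = shift p (k + l) x"
  by (simp add: shift_def mod_simps algebra_simps)

lemma shift_0: "x \<in> topspace (odometer_space p) \<Longrightarrow> shift p 0 x = x"
  by (simp add: shift_def in_odometer)

lemma continuous_shift: "continuous_map (odometer_space p) (odometer_space p) (shift p k)"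
  unfolding odometer_space_def continuous_map_into_sequence_space
proof
  fix i
  have "continuous_map (sequence_space (\<lambda>i. {0..<p i})) (discrete_topology {0..<p i}) (\<lambda>x. x i)"
    by (rule continuous_map_product_projection) simp
  moreover have "continuous_map (discrete_topology {0..<p i}) (discrete_topology {0..<p i}) (\<lambda>a. (a + k) mod p i)"
    using p_pos by simp
  ultimately have "continuous_map (sequence_space (\<lambda>i. {0..<p i})) (discrete_topology {0..<p i})
      ((\<lambda>a. (a + k) mod p i) \<circ> (\<lambda>x. x i))"
    by (rule continuous_map_compose)
  then show "continuous_map (sequence_space (\<lambda>i. {0..<p i})) (discrete_topology {0..<p i}) (\<lambda>x. shift p k x i)"
    by (simp only: shift_def o_def)
qed

lemma homeomorphic_shift: "homeomorphic_map (odometer_space p) (odometer_space p) (shift p 1)"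
proof -
  have "homeomorphic_maps (odometer_space p) (odometer_space p) (shift p 1) (shift p (-1))"
    by (simp add: homeomorphic_maps_def continuous_shift shift_shift shift_0)
  then show ?thesis using homeomorphic_maps_map by blast
qed

lemma shift_eq_imp_dvd: "shift p k x = shift p l x \<Longrightarrow> p i dvd k - l"
  by (drule fun_cong[of _ _ i]) (simp add: shift_def mod_eq_dvd_iff)

lemma shift_inject_small:
  assumes "shift p k x = shift p l x" "\<bar>k - l\<bar> \<le> 2"
  shows "k = l"
proof (rule ccontr)
  assume "k \<noteq> l"
  with shift_eq_imp_dvd[OF assms(1), of 0] have "p 0 \<le> \<bar>k - l\<bar>"
    by (intro zdvd_imp_le) auto
  with assms(2) p_ge_3[of 0] show False by linarith
qed

lemma odometer_edge:
  "(x, y) \<in> snd (odometer_graph p) \<longleftrightarrow>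
     x \<in> topspace (odometer_space p) \<and> y \<in> topspace (odometer_space p) \<and>
     (y = shift p 1 x \<or> y = shift p (-1) x)"
proof -
  have "x \<noteq> shift p 1 x" if "x \<in> topspace (odometer_space p)" for x
    using shift_inject_small[of 0 x 1] shift_0[OF that] by auto
  moreover have "x = shift p 1 y \<longleftrightarrow> y = shift p (-1) x"
    if "x \<in> topspace (odometer_space p)" "y \<in> topspace (odometer_space p)"
    using shift_shift[of 1 "-1" x] shift_shift[of "-1" 1 y] that by (auto simp: shift_0)
  ultimately show ?thesis
    using shift_in by (auto simp: odometer_graph_def mem_induced_graph)
qed

definition period :: "nat \<Rightarrow> int" where
  "period n = (\<Prod>i<n. p i)"

lemma odd_period: "odd (period n)"
  by (induction n) (simp_all add: period_def odd_p)

lemma period_pos: "0 < period n"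
  by (simp add: period_def prod_pos p_pos)

lemma shift_period:
  assumes "period n dvd k" "x \<in> topspace (odometer_space p)"
  shows "shift p k x \<in> cylinder (\<lambda>i. {0..<p i}) x n"
proof -
  have "shift p k x i = x i" if "i < n" for i
  proof -
    have "p i dvd period n" using that by (auto simp: period_def intro: dvd_prodI)
    then have "p i dvd k" using assms(1) dvd_trans by blast
    then have "(x i + k) mod p i = x i mod p i" by (simp add: mod_eq_dvd_iff)
    then show ?thesis using assms(2) by (simp add: shift_def in_odometer)
  qed
  then show ?thesis
    using shift_in[of k x] by (simp add: cylinder_def odometer_space_def del: topspace_product_topology)
qed

text \<open>A 2-colouring alternates along an orbit, but shifting by the odd number \<open>period n\<close> returns
  arbitrarily close to the starting point when \<open>n\<close> is large.\<close>
lemma odometer_graph_in_GG: "odometer_graph p \<in> GG 2"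
proof -
  let ?X = "odometer_space p"
  have "\<not> continuously_colorable (odometer_graph p) (enat 2)"
  proof
    assume "continuously_colorable (odometer_graph p) (enat 2)"
    then obtain c where c: "continuous_map ?X (discrete_topology {i. enat i < enat 2}) c"
      "coloring (snd (odometer_graph p)) c"
      by (auto simp: continuously_colorable_def odometer_graph_def)
    define x where "x = shift p 0 (\<lambda>_. 0)"
    have x: "x \<in> topspace ?X" by (simp add: x_def shift_in)
    have c2: "c y < 2" if "y \<in> topspace ?X" for y
      using c(1) that by (auto simp: continuous_map_def)
    have alt: "c (shift p (int n) x) = c x \<longleftrightarrow> even n" for n
    proof (induction n)
      case (Suc n)
      have "(shift p (int n) x, shift p (int (Suc n)) x) \<in> snd (odometer_graph p)"
        by (simp add: odometer_edge shift_in shift_shift)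
      then have "c (shift p (int n) x) \<noteq> c (shift p (int (Suc n)) x)"
        using c(2) by (auto simp: coloring_def)
      then show ?case
        using Suc c2[OF x] c2[OF shift_in[of "int n" x]] c2[OF shift_in[of "int (Suc n)" x]] by auto
    qed (simp add: shift_0 x)
    have "openin ?X {y \<in> topspace ?X. c y = c x}"
      using openin_preimage_discrete_map[OF c(1), of "\<lambda>i. i = c x"] .
    then obtain n where n: "cylinder (\<lambda>i. {0..<p i}) x n \<subseteq> {y \<in> topspace ?X. c y = c x}"
      unfolding odometer_space_def using x
      by (elim open_contains_cylinder[of _ _ x]) (simp_all add: odometer_space_def)
    then have "c (shift p (period n) x) = c x"
      using shift_period[OF dvd_refl x, of n] by blast
    then show False
      using alt[of "nat (period n)"] odd_period[of n] period_pos[of n] by (simp add: even_nat_iff)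
  qed
  then show ?thesis
    unfolding GG_iff using zdmc_odometer homeomorphic_shift by (auto simp: odometer_graph_def)
qed

text \<open>By the Chinese remainder theorem, finitely many coordinates can be prescribed along a forward
  (\<open>e = 1\<close>) or backward (\<open>e = -1\<close>) orbit, which therefore meets every cylinder.\<close>
lemma dense_orbit:
  assumes e: "e = 1 \<or> e = -1" and C: "closedin (odometer_space p) C"
    and x: "x \<in> topspace (odometer_space p)" and orb: "\<And>m::nat. shift p (e * int m) x \<in> C"
  shows "C = topspace (odometer_space p)"
proof (rule ccontr)
  assume "C \<noteq> topspace (odometer_space p)"
  then obtain y where y: "y \<in> topspace (odometer_space p) - C"
    using closedin_subset[OF C] by blast
  have "openin (odometer_space p) (topspace (odometer_space p) - C)" using C by blast
  then obtain n where n: "cylinder (\<lambda>i. {0..<p i}) y n \<subseteq> topspace (odometer_space p) - C"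
    unfolding odometer_space_def using y
    by (elim open_contains_cylinder[of _ _ y]) (simp_all add: odometer_space_def)
  have "\<exists>m. \<forall>i\<in>{..<n}. [m = nat ((e * (y i - x i)) mod p i)] (mod nat (p i))"
    using coprime_p p_pos by (intro chinese_remainder_nat) (auto simp: coprime_int_iff[symmetric] less_imp_le simp del: coprime_int_iff)
  then obtain m where m: "\<And>i. i < n \<Longrightarrow> [m = nat ((e * (y i - x i)) mod p i)] (mod nat (p i))" by auto
  have "shift p (e * int m) x i = y i" if "i < n" for i
  proof -
    have "[int m = (e * (y i - x i)) mod p i] (mod p i)"
      using m[OF that] p_pos[of i] by (simp add: cong_int_iff[symmetric] less_imp_le)
    then have "[int m = e * (y i - x i)] (mod p i)" by simp
    then have "[x i + e * int m = x i + e * (e * (y i - x i))] (mod p i)"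
      by (intro cong_add cong_mult) simp_all
    moreover have "x i + e * (e * (y i - x i)) = y i" using e by auto
    moreover have "y i mod p i = y i" using y by (simp add: in_odometer)
    ultimately show ?thesis by (simp add: shift_def cong_def)
  qed
  then have "shift p (e * int m) x \<in> cylinder (\<lambda>i. {0..<p i}) y n"
    using shift_in[of "e * int m" x] by (simp add: cylinder_def odometer_space_def del: topspace_product_topology)
  with n orb show False by blast
qed

end

text \<open>Along the orbit of a point, a reduction moves by signs that only depend on finitely many
  coordinates, hence repeat with an odd period; over this period the image moves by an odd number \<open>D\<close>.
  Multiples of a high period come back near the starting point, and so the modulus of a coordinate of
  the target that is coprime to all the moduli of the source would have to divide \<open>D\<close>.\<close>
lemma no_reduction_between_odometers:
  assumes p: "odd_moduli p" and q: "odd_moduli q"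
    and new: "\<And>b. \<exists>i. b < q i \<and> (\<forall>j. coprime (q i) (p j))"
  shows "\<not> odometer_graph p \<preceq>\<^sub>c odometer_graph q"
proof
  assume "odometer_graph p \<preceq>\<^sub>c odometer_graph q"
  interpret P: odd_moduli p by (rule p)
  interpret Q: odd_moduli q by (rule q)
  let ?X = "odometer_space p" and ?Y = "odometer_space q"
  obtain \<phi> where \<phi>: "continuous_map ?X ?Y \<phi>"
    "\<And>x y. (x, y) \<in> snd (odometer_graph p) \<Longrightarrow> (\<phi> x, \<phi> y) \<in> snd (odometer_graph q)"
    using \<open>odometer_graph p \<preceq>\<^sub>c odometer_graph q\<close>
    by (auto simp: reducible_c_def odometer_graph_def)
  have \<phi>Y: "\<phi> x \<in> topspace ?Y" if "x \<in> topspace ?X" for x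
    using \<phi>(1) that by (auto simp: continuous_map_def)
  define U where "U e = {x \<in> topspace ?X. (\<phi> \<circ> shift p 1) x = (shift q e \<circ> \<phi>) x}" for e
  have closedU: "closedin ?X (U e)" for e
    unfolding U_def
    by (rule closedin_continuous_maps_eq[OF zdmc_Hausdorff[OF Q.zdmc_odometer]])
      (rule continuous_map_compose P.continuous_shift Q.continuous_shift \<phi>)+
  have Ucases: "x \<in> U 1 \<or> x \<in> U (-1)" if "x \<in> topspace ?X" for x
    using \<phi>(2)[of x "shift p 1 x"] that by (auto simp: U_def P.odometer_edge Q.odometer_edge P.shift_in)
  have Udisj: "x \<notin> U (-1)" if "x \<in> U 1" for x
    using that Q.shift_inject_small[of 1 "\<phi> x" "-1"] by (auto simp: U_def)
  have "U e \<subseteq> topspace ?X" for e by (auto simp: U_def)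
  then have "topspace ?X - U (-1) = U 1"
    using Ucases Udisj by blast
  then have "openin ?X (U 1)" using closedU[of "-1"] by (metis closedin_def)
  then obtain n where n: "\<And>x y. x \<in> topspace ?X \<Longrightarrow> y \<in> cylinder (\<lambda>i. {0..<p i}) x n \<Longrightarrow> y \<in> U 1 \<longleftrightarrow> x \<in> U 1"
    using closedU[of 1] unfolding odometer_space_def
    by (elim clopen_finitely_determined[rotated]) auto
  define x where "x = shift p 0 (\<lambda>_. 0)"
  have x: "x \<in> topspace ?X" by (simp add: x_def P.shift_in)
  define s :: "nat \<Rightarrow> int" where "s k = (if shift p (int k) x \<in> U 1 then 1 else -1)" for k
  have s: "s k = 1 \<or> s k = -1" for k by (simp add: s_def)
  define m where "m = nat (P.period n)"
  have m: "int m = P.period n" "odd m"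
    using P.period_pos[of n] P.odd_period[of n] by (simp_all add: m_def even_nat_iff)
  have walk: "\<phi> (shift p (int k) x) = shift q (sum s {..<k}) (\<phi> x)" for k
  proof (induction k)
    case (Suc k)
    have "shift p (int k) x \<in> U (s k)"
      using Ucases[OF P.shift_in[of "int k" x]] by (auto simp: s_def)
    then have "\<phi> (shift p 1 (shift p (int k) x)) = shift q (s k) (\<phi> (shift p (int k) x))"
      by (simp add: U_def)
    then show ?case by (simp add: P.shift_shift Q.shift_shift Suc add.commute)
  qed (simp add: P.shift_0 Q.shift_0 x \<phi>Y)
  \<comment> \<open>A shift by \<open>m\<close> does not change the first \<open>n\<close> coordinates, on which the sign depends.\<close>
  have s_per: "s (k + m) = s k" for k
  proof -
    have "shift p (int (k + m)) x = shift p (int m) (shift p (int k) x)"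
      by (simp add: P.shift_shift add.commute)
    then have "shift p (int (k + m)) x \<in> cylinder (\<lambda>i. {0..<p i}) (shift p (int k) x) n"
      using P.shift_period[of n "int m" "shift p (int k) x"] m(1) P.shift_in by simp
    from n[OF P.shift_in this] show ?thesis by (simp add: s_def)
  qed
  have s_per': "s (k + l * m) = s k" for k l
    by (induction l) (use s_per[of "k + _ * m"] in \<open>simp_all add: algebra_simps\<close>)
  define D where "D = sum s {..<m}"
  have sum_per: "sum s {..<l * m} = int l * D" for l
  proof (induction l)
    case (Suc l)
    have "sum s {..<Suc l * m} = sum s {..<l * m} + sum s {l * m..<l * m + m}"
      by (simp add: lessThan_atLeast0 sum.atLeastLessThan_concat add.commute)
    also have "sum s {l * m..<l * m + m} = (\<Sum>k<m. s (k + l * m))"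
      using sum.shift_bounds_nat_ivl[of s 0 "l * m" m] by (simp add: lessThan_atLeast0 add.commute)
    also have "\<dots> = D" by (simp add: s_per' D_def)
    finally show ?case by (simp add: Suc algebra_simps)
  qed simp
  obtain i where i: "\<bar>D\<bar> < q i" "\<And>j. coprime (q i) (p j)" using new by blast
  have "openin ?X {y \<in> topspace ?X. \<phi> y \<in> {z \<in> topspace ?Y. z i = \<phi> x i}}"
    by (rule openin_continuous_map_preimage[OF \<phi>(1)])
      (simp add: odometer_space_def clopen_coordinate del: topspace_product_topology)
  then obtain n' where n': "cylinder (\<lambda>i. {0..<p i}) x n' \<subseteq> {y \<in> topspace ?X. \<phi> y \<in> {z \<in> topspace ?Y. z i = \<phi> x i}}"
    unfolding odometer_space_def using x \<phi>Y[OF x]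
    by (elim open_contains_cylinder[of _ _ x]) (simp_all add: odometer_space_def)
  define l where "l = nat (P.period n')"
  have l: "int l = P.period n'" using P.period_pos[of n'] by (simp add: l_def)
  have "shift p (int (l * m)) x \<in> cylinder (\<lambda>i. {0..<p i}) x n'"
    by (rule P.shift_period[OF _ x]) (simp add: l)
  then have "\<phi> (shift p (int (l * m)) x) i = \<phi> x i" using n' by blast
  then have "(\<phi> x i + int l * D) mod q i = \<phi> x i mod q i"
    using \<phi>Y[OF x] unfolding walk sum_per by (simp add: shift_def Q.in_odometer)
  then have "q i dvd P.period n' * D" by (simp add: mod_eq_dvd_iff l)
  moreover have "coprime (q i) (P.period n')"
    unfolding P.period_def by (rule prod_coprime_right) (rule i(2))
  ultimately have "q i dvd D" by (simp add: coprime_dvd_mult_right_iff)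
  moreover have "D \<noteq> 0"
    using sum_of_signs(1)[of s m, OF s] m(2) unfolding D_def by auto
  ultimately show False
    using i(1) zdvd_imp_le[of "q i" "\<bar>D\<bar>"] by auto
qed

text \<open>Let \<open>g\<close> be the homeomorphism of \<open>H\<close>. Its space splits into the clopen sets of the points that \<open>g\<close> moves forward
  along the odometer, moves backward, and fixes. If the direction changed at every step, then every orbit
  would have at most two points and the forward set would yield a 2-colouring. Otherwise two successive
  steps of some orbit go in the same direction; by injectivity the orbit keeps this direction for ever.
  Its image is then dense, so that the reduction is a homeomorphism and its inverse is a reduction.\<close>
lemma odometer_graph_rigid:
  assumes p: "odd_moduli p" and H: "H \<in> GG 2" and le: "H \<preceq>\<^sup>i\<^sub>c odometer_graph p"
  shows "odometer_graph p \<preceq>\<^sub>c H"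
proof -
  interpret odd_moduli p by (rule p)
  let ?X = "odometer_space p"
  obtain Y g where HY: "H = (Y, induced_graph (topspace Y) g)" and Y: "zdmc_space Y"
    and g: "homeomorphic_map Y Y g"
    and nc: "\<not> continuously_colorable (Y, induced_graph (topspace Y) g) (enat 2)"
    using H by (auto simp: GG_iff)
  have gc: "continuous_map Y Y g" and gi: "inj_on g (topspace Y)"
    using g homeomorphic_imp_continuous_map homeomorphic_imp_injective_map by blast+
  then have gY: "g y \<in> topspace Y" if "y \<in> topspace Y" for y
    using that by (auto simp: continuous_map_def)
  have g_eq: "g y = g z \<longleftrightarrow> y = z" if "y \<in> topspace Y" "z \<in> topspace Y" for y z
    using gi that by (auto simp: inj_on_def)
  obtain \<phi> where \<phi>: "continuous_map Y ?X \<phi>" "inj_on \<phi> (topspace Y)"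
    "\<And>y z. (y, z) \<in> induced_graph (topspace Y) g \<Longrightarrow> (\<phi> y, \<phi> z) \<in> snd (odometer_graph p)"
    using le by (auto simp: reducible_ic_def HY odometer_graph_def)
  have \<phi>X: "\<phi> y \<in> topspace ?X" if "y \<in> topspace Y" for y
    using \<phi>(1) that by (auto simp: continuous_map_def)
  have \<phi>_eq: "\<phi> y = \<phi> z \<longleftrightarrow> y = z" if "y \<in> topspace Y" "z \<in> topspace Y" for y z
    using \<phi>(2) that by (auto simp: inj_on_def)
  \<comment> \<open>The points that \<open>g\<close> moves by \<open>e\<close> places; only the values 1, -1 and 0 of \<open>e\<close> matter.\<close>
  define D where "D e = {y \<in> topspace Y. (\<phi> \<circ> g) y = (shift p e \<circ> \<phi>) y}" for e
  have D_iff: "y \<in> D e \<longleftrightarrow> y \<in> topspace Y \<and> \<phi> (g y) = shift p e (\<phi> y)" for y e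
    by (simp add: D_def)
  have closedD: "closedin Y (D e)" for e
    unfolding D_def
    by (rule closedin_continuous_maps_eq[OF zdmc_Hausdorff[OF zdmc_odometer]])
      (rule continuous_map_compose continuous_shift \<phi>(1) gc)+
  have D0: "y \<in> D 0 \<longleftrightarrow> y \<in> topspace Y \<and> g y = y" for y
    using \<phi>X gY \<phi>_eq by (auto simp: D_iff shift_0)
  have Dcases: "y \<in> D 1 \<or> y \<in> D (-1) \<or> y \<in> D 0" if "y \<in> topspace Y" for y
  proof (cases "g y = y")
    case False
    with that have "(\<phi> y, \<phi> (g y)) \<in> snd (odometer_graph p)"
      by (intro \<phi>(3)) (simp add: mem_induced_graph)
    with that show ?thesis by (auto simp: D_iff odometer_edge)
  qed (use that in \<open>simp add: D0\<close>)
  have Ddisj: "e = e'" if "y \<in> D e" "y \<in> D e'" "\<bar>e - e'\<bar> \<le> 2" for y e e'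
    using that shift_inject_small[of e "\<phi> y" e'] by (auto simp: D_iff)
  have "\<exists>y e. (e = 1 \<or> e = -1) \<and> y \<in> D e \<and> g y \<in> D e"
  proof (rule ccontr)
    assume neg: "\<not> ?thesis"
    define c :: "_ \<Rightarrow> nat" where "c y = (if y \<in> D 1 then 1 else 0)" for y
    have "z \<notin> D (-1)" "z \<notin> D 0" if "z \<in> D 1" for z
      using that Ddisj[of z 1 "-1"] Ddisj[of z 1 0] by auto
    moreover have "D e \<subseteq> topspace Y" for e by (auto simp: D_iff)
    ultimately have "topspace Y - D 1 = D (-1) \<union> D 0"
      using Dcases by blast
    then have "openin Y (D 1)"
      using closedD by (metis closedin_Un closedin_def closedin_subset double_diff openin_closedin_eq)
    moreover have "{y \<in> topspace Y. c y = 1} = D 1" "{y \<in> topspace Y. c y = 0} = topspace Y - D 1"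
      by (auto simp: c_def D_iff)
    ultimately have "openin Y {y \<in> topspace Y. c y = i}" if "i \<in> {0, 1}" for i
      using that closedD[of 1] by (auto simp: openin_diff)
    moreover have "{i. enat i < enat 2} = {0, 1}" by auto
    ultimately have "continuous_map Y (discrete_topology {i. enat i < enat 2}) c"
      unfolding continuous_map_into_discrete by (auto simp: c_def)
    moreover have flip: "c y \<noteq> c (g y)" if y: "y \<in> topspace Y" "g y \<noteq> y" for y
    proof -
      have "y \<notin> D 0" "g y \<notin> D 0" using y g_eq gY by (auto simp: D0)
      then show ?thesis
        using neg Dcases[OF y(1)] Dcases[OF gY[OF y(1)]] by (auto simp: c_def)
    qed
    then have "coloring (induced_graph (topspace Y) g) c"
      by (auto simp: coloring_def mem_induced_graph flip flip[symmetric])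
    ultimately have "continuously_colorable (Y, induced_graph (topspace Y) g) (enat 2)"
      unfolding continuously_colorable_def by blast
    with nc show False ..
  qed
  then obtain y e where e: "e = 1 \<or> e = -1" and y: "y \<in> D e" "g y \<in> D e" by blast
  \<comment> \<open>Fixed points have only themselves as preimage, and a turn back would close the orbit after two steps.\<close>
  have orb: "(g ^^ n) y \<in> D e \<and> g ((g ^^ n) y) \<in> D e" for n
  proof (induction n)
    case (Suc n)
    define z where "z = (g ^^ n) y"
    have z: "z \<in> D e" "g z \<in> D e" using Suc by (auto simp: z_def)
    then have zY: "z \<in> topspace Y" by (simp add: D_iff)
    have "g (g z) \<notin> D 0"
    proof
      assume "g (g z) \<in> D 0"
      then have "z \<in> D 0" using zY gY g_eq by (auto simp: D0)
      with Ddisj[OF z(1), of 0] e show False by auto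
    qed
    moreover have "g (g z) \<notin> D (- e)"
    proof
      assume "g (g z) \<in> D (- e)"
      then have "\<phi> (g (g (g z))) = shift p (- e) (shift p e (\<phi> (g z)))"
        using z(2) by (simp add: D_iff)
      also have "\<dots> = \<phi> (g z)" using zY gY \<phi>X by (simp add: shift_shift shift_0)
      finally have "g (g z) = z" using zY gY g_eq \<phi>_eq by auto
      then have "shift p (e + e) (\<phi> z) = shift p 0 (\<phi> z)"
        using z zY \<phi>X by (simp add: D_iff shift_shift shift_0)
      then show False using shift_inject_small e by fastforce
    qed
    ultimately have "g (g z) \<in> D e" using Dcases[of "g (g z)"] e zY gY by auto
    with z(2) show ?case by (simp add: z_def)
  qed (use y in simp)
  have orbit: "\<phi> ((g ^^ n) y) = shift p (e * int n) (\<phi> y)" for n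
  proof (induction n)
    case 0
    then show ?case using y(1) \<phi>X by (simp add: D_iff shift_0)
  next
    case (Suc n)
    then show ?case using orb[of n] by (simp add: D_iff shift_shift algebra_simps)
  qed
  have "compactin Y (D e)"
    using closedD zdmc_compact[OF Y] closedin_compact_space by blast
  then have "closedin ?X (\<phi> ` D e)"
    using \<phi>(1) zdmc_Hausdorff[OF zdmc_odometer] image_compactin compactin_imp_closedin by blast
  moreover have "shift p (e * int n) (\<phi> y) \<in> \<phi> ` D e" for n
    using orb[of n] orbit[of n] by (metis imageI)
  ultimately have onto: "\<phi> ` D e = topspace ?X"
    using dense_orbit[OF e, of "\<phi> ` D e" "\<phi> y"] y(1) \<phi>X by (auto simp: D_iff)
  have "D e \<subseteq> topspace Y" by (auto simp: D_iff)
  with onto have img: "\<phi> ` topspace Y = topspace ?X"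
    using \<phi>X by blast
  have all: "z \<in> D e" if z: "z \<in> topspace Y" for z
  proof -
    have "\<phi> z \<in> \<phi> ` D e" using onto \<phi>X[OF z] by simp
    then show ?thesis using z \<phi>_eq by (auto simp: D_iff)
  qed
  have "homeomorphic_map Y ?X \<phi>"
    using continuous_imp_homeomorphic_map[OF \<phi>(1) zdmc_compact[OF Y] zdmc_Hausdorff[OF zdmc_odometer] img \<phi>(2)] .
  then obtain \<psi> where \<psi>: "homeomorphic_maps Y ?X \<phi> \<psi>"
    using homeomorphic_map_maps by blast
  then have \<psi>c: "continuous_map ?X Y \<psi>" and \<psi>\<phi>: "\<And>z. z \<in> topspace Y \<Longrightarrow> \<psi> (\<phi> z) = z"
    and \<phi>\<psi>: "\<And>x. x \<in> topspace ?X \<Longrightarrow> \<phi> (\<psi> x) = x"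
    by (auto simp: homeomorphic_maps_def)
  have \<psi>Y: "\<psi> x \<in> topspace Y" if "x \<in> topspace ?X" for x
    using \<psi>c that by (auto simp: continuous_map_def)
  have \<psi>_shift: "\<psi> (shift p e x) = g (\<psi> x)" if "x \<in> topspace ?X" for x
    using all[OF \<psi>Y[OF that]] \<psi>\<phi>[OF gY[OF \<psi>Y[OF that]]] \<phi>\<psi>[OF that] by (simp add: D_iff)
  have "(\<psi> x, \<psi> x') \<in> snd H" if xx': "(x, x') \<in> snd (odometer_graph p)" for x x'
  proof -
    have X: "x \<in> topspace ?X" "x' \<in> topspace ?X" and adj: "x' = shift p 1 x \<or> x' = shift p (-1) x"
      using xx' by (auto simp: odometer_edge)
    have "x \<noteq> x'"
      using adj shift_inject_small[of 0 x 1] shift_inject_small[of 0 x "-1"] shift_0[OF X(1)] by auto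
    then have "\<psi> x \<noteq> \<psi> x'" using \<phi>\<psi> X by metis
    moreover have "x' = shift p e x \<or> x = shift p e x'"
      using adj e shift_0[OF X(1)] by (auto simp: shift_shift)
    then have "\<psi> x' = g (\<psi> x) \<or> \<psi> x = g (\<psi> x')"
      using \<psi>_shift X by auto
    ultimately show ?thesis
      using X \<psi>Y by (auto simp: HY mem_induced_graph)
  qed
  with \<psi>c show ?thesis
    by (auto simp: reducible_c_def HY odometer_graph_def intro!: exI[of _ \<psi>])
qed


section \<open>The minimum graphs for zero and one colour\<close>

lemma zdmc_finite_discrete: "finite A \<Longrightarrow> zdmc_space (discrete_topology A)"
proof -
  assume "finite A"
  moreover have "zero_dimensional_space (discrete_topology A)"
    unfolding zero_dimensional_space_iff by (metis closedin_discrete_topology openin_discrete_topology order_refl)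
  ultimately show ?thesis
    by (simp add: zdmc_space_def metrizable_space_discrete_topology compact_space_discrete_topology)
qed

lemma one_graph_in_GG: "one_graph \<in> GG 0"
proof -
  have "one_graph = (discrete_topology {0}, induced_graph (topspace (discrete_topology {0})) id)"
    by (auto simp: one_graph_def mem_induced_graph)
  moreover have "homeomorphic_map (discrete_topology {0}) (discrete_topology {0}) (id :: nat \<Rightarrow> nat)"
    by simp
  moreover have "\<not> continuously_colorable one_graph (enat 0)"
    by (auto simp: one_graph_def continuously_colorable_def)
  ultimately show ?thesis
    unfolding GG_iff using zdmc_finite_discrete[of "{0}"] by blast
qed

lemma one_graph_minimum:
  assumes "G \<in> GG 0"
  shows "one_graph \<preceq>\<^sup>i\<^sub>c G"
proof -
  obtain X f where G: "G = (X, induced_graph (topspace X) f)"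
    and nc: "\<not> continuously_colorable G (enat 0)"
    using assms by (auto simp: GG_iff)
  have "topspace X \<noteq> {}"
  proof
    assume "topspace X = {}"
    then have "continuously_colorable G (enat 0)"
      by (auto simp: G continuously_colorable_def continuous_map_into_discrete coloring_def mem_induced_graph)
    with nc show False ..
  qed
  then obtain x where "x \<in> topspace X" by blast
  then show ?thesis
    by (auto simp: reducible_ic_def one_graph_def G intro!: exI[of _ "\<lambda>_. x"])
qed

lemma two_graph_edge: "snd two_graph = {(0, 1), (1, 0)}"
  by (auto simp: two_graph_def mem_induced_graph)

lemma two_graph_in_GG: "two_graph \<in> GG 1"
proof -
  let ?D = "discrete_topology {0, 1::nat}"
  have "homeomorphic_maps ?D ?D (\<lambda>\<epsilon>. 1 - \<epsilon>) (\<lambda>\<epsilon>. 1 - \<epsilon>)"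
    by (auto simp: homeomorphic_maps_def)
  then have "homeomorphic_map ?D ?D (\<lambda>\<epsilon>. 1 - \<epsilon>)"
    using homeomorphic_maps_map by blast
  moreover have "\<not> continuously_colorable two_graph (enat 1)"
  proof
    assume "continuously_colorable two_graph (enat 1)"
    then obtain c where c: "continuous_map ?D (discrete_topology {i. enat i < enat 1}) c"
      "coloring (snd two_graph) c"
      by (auto simp: continuously_colorable_def two_graph_def)
    then have "c 0 = 0" "c 1 = 0" by (auto simp: continuous_map_def)
    with c(2) show False by (auto simp: coloring_def two_graph_edge)
  qed
  ultimately show ?thesis
    unfolding GG_iff using zdmc_finite_discrete[of "{0, Suc 0}"]
    by (intro exI[of _ ?D] exI[of _ "\<lambda>\<epsilon>. 1 - \<epsilon>"]) (simp add: two_graph_def)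
qed

lemma two_graph_minimum:
  assumes "G \<in> GG 1"
  shows "two_graph \<preceq>\<^sup>i\<^sub>c G"
proof -
  obtain X f where G: "G = (X, induced_graph (topspace X) f)" and f: "homeomorphic_map X X f"
    and nc: "\<not> continuously_colorable G (enat 1)"
    using assms by (auto simp: GG_iff)
  have "\<exists>x\<in>topspace X. f x \<noteq> x"
  proof (rule ccontr)
    assume "\<not> ?thesis"
    then have "coloring (induced_graph (topspace X) f) (\<lambda>_. 0::nat)"
      by (auto simp: coloring_def mem_induced_graph)
    moreover have "continuous_map X (discrete_topology {i. enat i < enat 1}) (\<lambda>_. 0)" by simp
    ultimately have "continuously_colorable G (enat 1)"
      unfolding continuously_colorable_def G by blast
    with nc show False ..
  qed
  then obtain x where x: "x \<in> topspace X" "f x \<noteq> x" by blast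
  have "f x \<in> topspace X"
    using x(1) f homeomorphic_imp_continuous_map continuous_map_funspace by blast
  then show ?thesis
    unfolding reducible_ic_def two_graph_edge using x
    by (intro exI[of _ "\<lambda>\<epsilon>. if \<epsilon> = 0 then x else f x"])
      (auto simp: two_graph_def G mem_induced_graph inj_on_def)
qed

section \<open>Copies in another type\<close>

text \<open>The examples live on function spaces; an injection \<open>j\<close> carries them over to any type that is large enough.\<close>
definition copy_graph :: "('a \<Rightarrow> 'b) \<Rightarrow> 'a tgraph \<Rightarrow> 'b tgraph" where
  "copy_graph j G =
     (pullback_topology (j ` topspace (fst G)) (inv_into (topspace (fst G)) j) (fst G),
      map_prod j j ` snd G)"

lemma copy_graph:
  assumes j: "inj j" and G: "G \<in> GG k"
  shows "copy_graph j G \<in> GG k" "G \<preceq>\<^sup>i\<^sub>c copy_graph j G" "copy_graph j G \<preceq>\<^sup>i\<^sub>c G"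
proof -
  obtain X f where GX: "G = (X, induced_graph (topspace X) f)" and X: "zdmc_space X"
    and f: "homeomorphic_map X X f" and nc: "\<not> continuously_colorable G (enat k)"
    using G by (auto simp: GG_iff)
  let ?S = "topspace X"
  define i where "i = inv_into ?S j"
  define X' where "X' = pullback_topology (j ` ?S) i X"
  have ij: "i (j x) = x" if "x \<in> ?S" for x
    using that j unfolding i_def by (meson inj_on_subset inv_into_f_f subset_UNIV)
  have open': "openin X' V \<longleftrightarrow> (\<exists>U. openin X U \<and> V = j ` U)" for V
  proof -
    have pre: "i -` U \<inter> j ` ?S = j ` U" if "openin X U" for U
      using openin_subset[OF that] ij by (auto simp: image_iff)
    show ?thesis
      unfolding X'_def openin_pullback_topology by (intro iff_exI conj_cong refl) (simp only: pre)
  qed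
  have topX': "topspace X' = j ` ?S"
    using open' openin_subset by (fastforce simp: topspace_def)
  have pre: "{x \<in> ?S. j x \<in> j ` U} = U" if "openin X U" for U
    using openin_subset[OF that] injD[OF j] by auto
  have cj: "continuous_map X X' j"
    unfolding continuous_map_def topX' using open' pre by auto
  have ci: "continuous_map X' X i"
  proof -
    have "openin X' {y \<in> topspace X'. i y \<in> U}" if "openin X U" for U
    proof -
      have "{y \<in> topspace X'. i y \<in> U} = j ` U"
        using openin_subset[OF that] ij by (auto simp: topX' image_iff)
      then show ?thesis using that open' by blast
    qed
    then show ?thesis unfolding continuous_map_def using ij by (auto simp: topX')
  qed
  have hm: "homeomorphic_maps X X' j i"
    using cj ci ij by (auto simp: homeomorphic_maps_def topX')
  then have hj: "homeomorphic_map X X' j" and hi: "homeomorphic_map X' X i"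
    using homeomorphic_maps_map by blast+
  have f_in: "f x \<in> ?S" if "x \<in> ?S" for x
    using that f homeomorphic_imp_continuous_map continuous_map_funspace by blast
  define f' where "f' = j \<circ> f \<circ> i"
  have f': "homeomorphic_map X' X' f'"
    unfolding f'_def using homeomorphic_map_compose[OF hi] homeomorphic_map_compose[OF f hj]
    by (metis comp_assoc)
  have edges: "map_prod j j ` snd G = induced_graph (topspace X') f'"
  proof -
    have "(u, v) \<in> map_prod j j ` snd G \<longleftrightarrow> (u, v) \<in> induced_graph (topspace X') f'" for u v
    proof -
      have "(u, v) \<in> map_prod j j ` snd G \<longleftrightarrow> (\<exists>x y. u = j x \<and> v = j y \<and> (x, y) \<in> snd G)"
        by (simp add: image_def Bex_def) blast
      also have "\<dots> \<longleftrightarrow> (\<exists>x\<in>?S. x \<noteq> f x \<and> (u = j x \<and> v = j (f x) \<or> v = j x \<and> u = j (f x)))"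
        unfolding GX snd_conv mem_induced_graph by metis
      also have "\<dots> \<longleftrightarrow> (u, v) \<in> induced_graph (topspace X') f'"
      proof
        assume "\<exists>x\<in>?S. x \<noteq> f x \<and> (u = j x \<and> v = j (f x) \<or> v = j x \<and> u = j (f x))"
        then obtain x where x: "x \<in> ?S" "x \<noteq> f x" "u = j x \<and> v = j (f x) \<or> v = j x \<and> u = j (f x)"
          by blast
        then show "(u, v) \<in> induced_graph (topspace X') f'"
          using ij[OF x(1)] by (auto simp: mem_induced_graph topX' f'_def inj_eq[OF j])
      next
        assume "(u, v) \<in> induced_graph (topspace X') f'"
        then obtain x where x: "x \<in> ?S" "u \<noteq> v"
          "u = j x \<and> v = j (f (i (j x))) \<or> v = j x \<and> u = j (f (i (j x)))"
          by (auto simp: mem_induced_graph topX' f'_def)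
        then show "\<exists>x\<in>?S. x \<noteq> f x \<and> (u = j x \<and> v = j (f x) \<or> v = j x \<and> u = j (f x))"
          using ij[OF x(1)] by (intro bexI[OF _ x(1)]) auto
      qed
      finally show ?thesis .
    qed
    then show ?thesis by auto
  qed
  have copy: "copy_graph j G = (X', induced_graph (topspace X') f')"
    using edges by (simp add: copy_graph_def GX X'_def i_def)
  show le: "G \<preceq>\<^sup>i\<^sub>c copy_graph j G"
    unfolding reducible_ic_def copy_graph_def
    using cj j by (intro exI[of _ j]) (auto simp: GX X'_def i_def inj_on_def)
  show "copy_graph j G \<preceq>\<^sup>i\<^sub>c G"
    unfolding reducible_ic_def
  proof (intro exI[of _ i] conjI)
    show "continuous_map (fst (copy_graph j G)) (fst G) i" unfolding copy using ci by (simp add: GX)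
    show "inj_on i (topspace (fst (copy_graph j G)))"
      using ij by (auto simp: copy topX' inj_on_def)
    show "\<forall>(x, y)\<in>snd (copy_graph j G). (i x, i y) \<in> snd G"
      using ij f_in by (auto simp: copy_graph_def GX mem_induced_graph)
  qed
  have "\<not> continuously_colorable (copy_graph j G) (enat k)"
    using reducible_c_colorable[OF reducible_ic_imp_c[OF le]] nc by blast
  then show "copy_graph j G \<in> GG k"
    unfolding GG_iff using zdmc_homeomorphic[OF hj X] f' copy by blast
qed

text \<open>A sequence is encoded by its graph, a set of pairs of natural numbers.\<close>
lemma inj_sequences_into:
  assumes "continuum \<lesssim> (UNIV :: 'u set)"
  obtains j :: "(nat \<Rightarrow> 'c::countable) \<Rightarrow> 'u" where "inj j"
proof -
  obtain h :: "nat set \<Rightarrow> 'u" where h: "inj h"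
    using assms by (auto simp: lepoll_def)
  define g :: "(nat \<Rightarrow> 'c) \<Rightarrow> nat set" where "g s = range (\<lambda>n. prod_encode (n, to_nat (s n)))" for s
  have "inj g"
  proof (rule injI, rule ext)
    fix s t :: "nat \<Rightarrow> 'c" and n assume "g s = g t"
    then have "prod_encode (n, to_nat (s n)) \<in> g t" by (auto simp: g_def)
    then show "s n = t n" by (auto simp: g_def)
  qed
  then have "inj (h \<circ> g)" using h inj_compose by blast
  then show ?thesis by (rule that)
qed

section \<open>Counting graphs up to isomorphism\<close>

definition clopen_base :: "'a topology \<Rightarrow> (nat \<Rightarrow> 'a set) \<Rightarrow> bool" where
  "clopen_base X U \<longleftrightarrow> (\<forall>n. openin X (U n) \<and> closedin X (U n)) \<and>
     (\<forall>W x. openin X W \<and> x \<in> W \<longrightarrow> (\<exists>n. x \<in> U n \<and> U n \<subseteq> W))"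

lemma clopen_baseD:
  assumes "clopen_base X U"
  shows "openin X (U n)" "closedin X (U n)" "openin X W \<Longrightarrow> x \<in> W \<Longrightarrow> \<exists>n. x \<in> U n \<and> U n \<subseteq> W"
  using assms unfolding clopen_base_def by blast+

text \<open>For each \<open>n\<close> finitely many clopen sets inside balls of radius \<open>1 / Suc n\<close> cover the space; all of them
  together are a countable base.\<close>
lemma zdmc_clopen_base:
  assumes X: "zdmc_space X"
  obtains U where "clopen_base X U"
proof -
  obtain M d where M: "Metric_space M d" "X = Metric_space.mtopology M d"
    using X by (auto simp: zdmc_space_def metrizable_space_def)
  interpret Metric_space M d by (rule M(1))
  have MX: "topspace X = M" using M(2) by simp
  define small where "small n = {V. openin X V \<and> closedin X V \<and> (\<exists>c\<in>M. V \<subseteq> mball c (1 / real (Suc n)))}" for n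
  have "\<exists>\<F>. finite \<F> \<and> \<F> \<subseteq> small n \<and> topspace X \<subseteq> \<Union>\<F>" for n
  proof -
    have "x \<in> \<Union>(small n)" if x: "x \<in> topspace X" for x
    proof -
      have b: "openin X (mball x (1 / real (Suc n)))" "x \<in> mball x (1 / real (Suc n))"
        using x MX M(2) by auto
      obtain V where "openin X V" "closedin X V" "x \<in> V" "V \<subseteq> mball x (1 / real (Suc n))"
        by (rule zdmc_clopen_nbhd[OF X b])
      then show ?thesis using x MX by (auto simp: small_def)
    qed
    moreover have "\<forall>V\<in>small n. openin X V" by (simp add: small_def)
    ultimately show ?thesis
      by (intro zdmc_compact[OF X, unfolded compact_space_alt, rule_format] conjI subsetI)
  qed
  then obtain \<F> where F: "\<And>n. finite (\<F> n)" "\<And>n. \<F> n \<subseteq> small n" "\<And>n. topspace X \<subseteq> \<Union>(\<F> n)"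
    by metis
  define B where "B = insert {} (\<Union>n. \<F> n)"
  have B: "countable B" "B \<noteq> {}" "\<And>V. V \<in> B \<Longrightarrow> openin X V \<and> closedin X V"
    using F(1,2) by (auto simp: B_def small_def intro: countable_finite)
  have "\<exists>V\<in>B. x \<in> V \<and> V \<subseteq> W" if W: "openin X W" "x \<in> W" for W x
  proof -
    have xM: "x \<in> M" using W openin_subset MX by blast
    obtain r where r: "r > 0" "mball x r \<subseteq> W"
      using W M(2) by (auto simp: openin_mtopology)
    have "0 < r / 2" using r(1) by simp
    obtain n where n: "inverse (real (Suc n)) < r / 2" using reals_Archimedean[OF \<open>0 < r / 2\<close>] by blast
    obtain V where V: "V \<in> \<F> n" "x \<in> V" using F(3)[of n] xM MX by blast
    then obtain c where c: "c \<in> M" "V \<subseteq> mball c (1 / real (Suc n))" using F(2)[of n] by (auto simp: small_def)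
    have "V \<subseteq> mball x r"
    proof
      fix y assume "y \<in> V"
      then have y: "y \<in> M" "d c y < r / 2" using c(2) n by (auto simp: inverse_eq_divide)
      moreover have "d c x < r / 2" using V(2) c(2) n by (auto simp: inverse_eq_divide)
      ultimately show "y \<in> mball x r"
        using triangle[OF xM c(1) y(1)] commute[of x c] xM by simp
    qed
    with r V show ?thesis by (auto simp: B_def)
  qed
  then have "clopen_base X (from_nat_into B)"
    unfolding clopen_base_def
    using B from_nat_into[OF B(2)] from_nat_into_surj[OF B(1)] by metis
  then show ?thesis by (rule that)
qed

definition prefix_code :: "(nat \<Rightarrow> 'a set) \<Rightarrow> nat \<Rightarrow> 'a \<Rightarrow> nat" where
  "prefix_code U n x = set_encode {i. i < n \<and> x \<in> U i}"

lemma prefix_code_eq_iff: "prefix_code U n x = prefix_code V n y \<longleftrightarrow> (\<forall>i<n. x \<in> U i \<longleftrightarrow> y \<in> V i)"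
  unfolding prefix_code_def by (subst set_encode_eq) auto

text \<open>A countable invariant: which pairs of initial segments of codes are realised by related points, where the code
  of a point is the set of the indices of the basic clopen sets that contain it.\<close>
definition signature :: "(nat \<Rightarrow> 'a set) \<Rightarrow> ('a \<times> 'a) set \<Rightarrow> (nat \<times> nat \<times> nat) set" where
  "signature U R = {(n, prefix_code U n x, prefix_code U n y) | n x y. (x, y) \<in> R}"

text \<open>The edge relation itself need not be closed when edges shrink to a fixed point; its union with the diagonal is.\<close>
definition closed_reflexive :: "'a topology \<Rightarrow> ('a \<times> 'a) set \<Rightarrow> bool" where
  "closed_reflexive X R \<longleftrightarrow> closedin (prod_topology X X) R \<and> Id_on (topspace X) \<subseteq> R"

text \<open>The points of \<open>Y\<close> whose code agrees with that of \<open>x\<close> up to \<open>n\<close> form decreasing closed sets. The diagonal of \<open>R\<close>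
  makes the initial segments of the code of \<open>x\<close> visible in the signature, so that these sets are non-empty.\<close>
lemma signature_point:
  assumes Y: "compact_space Y" "clopen_base Y V" "closed_reflexive Y S"
    and X: "closed_reflexive X R" and sig: "signature U R = signature V S" and x: "x \<in> topspace X"
  shows "\<exists>y\<in>topspace Y. \<forall>i. x \<in> U i \<longleftrightarrow> y \<in> V i"
proof -
  define K where "K n = {y \<in> topspace Y. \<forall>i<n. x \<in> U i \<longleftrightarrow> y \<in> V i}" for n
  have "closedin Y (K n)" for n
  proof (induction n)
    case (Suc n)
    have "V n \<subseteq> topspace Y" using clopen_baseD(1)[OF Y(2)] openin_subset by blast
    then have "K (Suc n) = K n \<inter> (if x \<in> U n then V n else topspace Y - V n)"
      by (auto simp: K_def less_Suc_eq)
    moreover have "closedin Y (if x \<in> U n then V n else topspace Y - V n)"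
      using clopen_baseD(1,2)[OF Y(2)] by (auto intro: closedin_diff)
    ultimately show ?case using Suc by (simp only: closedin_Int)
  qed (simp add: K_def)
  moreover have "K n \<noteq> {}" for n
  proof -
    have "(x, x) \<in> R" using X x by (auto simp: closed_reflexive_def)
    then have "(n, prefix_code U n x, prefix_code U n x) \<in> signature V S"
      unfolding sig[symmetric] by (auto simp: signature_def)
    then obtain a b where ab: "(a, b) \<in> S" "prefix_code U n x = prefix_code V n a"
      by (auto simp: signature_def)
    then have "a \<in> topspace Y"
      using Y(3) closedin_subset by (fastforce simp: closed_reflexive_def)
    with ab show ?thesis by (auto simp: K_def prefix_code_eq_iff)
  qed
  moreover have "decseq K" by (auto simp: decseq_def K_def)
  ultimately have "(\<Inter>n. K n) \<noteq> {}" by (rule compact_space_imp_nest[OF Y(1)])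
  then obtain y where y: "\<And>n. y \<in> K n" by blast
  have "x \<in> U i \<longleftrightarrow> y \<in> V i" for i
    using y[of "Suc i"] by (simp add: K_def)
  moreover have "y \<in> topspace Y" using y[of 0] by (simp add: K_def)
  ultimately show ?thesis by blast
qed

text \<open>If \<open>(x', y')\<close> were outside the closed relation \<open>S\<close>, a product of two basic sets around it would miss \<open>S\<close>;
  but the signature provides a pair of \<open>S\<close> in this product.\<close>
lemma signature_relation:
  assumes V: "clopen_base Y V" and S: "closed_reflexive Y S"
    and sig: "signature U R = signature V S" and xy: "(x, y) \<in> R"
    and x': "x' \<in> topspace Y" "\<And>i. x \<in> U i \<longleftrightarrow> x' \<in> V i"
    and y': "y' \<in> topspace Y" "\<And>i. y \<in> U i \<longleftrightarrow> y' \<in> V i"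
  shows "(x', y') \<in> S"
proof (rule ccontr)
  assume "(x', y') \<notin> S"
  moreover have "openin (prod_topology Y Y) (topspace Y \<times> topspace Y - S)"
    using S unfolding closed_reflexive_def closedin_def by simp
  ultimately obtain A B where AB: "openin Y A" "openin Y B" "x' \<in> A" "y' \<in> B" "A \<times> B \<subseteq> topspace Y \<times> topspace Y - S"
    using x'(1) y'(1) unfolding openin_prod_topology_alt by (metis DiffI SigmaI)
  obtain i k where ik: "x' \<in> V i" "V i \<subseteq> A" "y' \<in> V k" "V k \<subseteq> B"
    using clopen_baseD(3)[OF V AB(1,3)] clopen_baseD(3)[OF V AB(2,4)] by blast
  define n where "n = Suc (max i k)"
  have "(n, prefix_code U n x, prefix_code U n y) \<in> signature V S"
    unfolding sig[symmetric] using xy by (auto simp: signature_def)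
  then obtain a b where ab: "(a, b) \<in> S" "prefix_code U n x = prefix_code V n a" "prefix_code U n y = prefix_code V n b"
    by (auto simp: signature_def)
  then have "a \<in> V i" "b \<in> V k"
    using ik x'(2) y'(2) by (auto simp: prefix_code_eq_iff n_def less_Suc_eq_le)
  with ik AB(5) ab(1) show False by blast
qed

lemma clopen_base_separates:
  assumes "clopen_base X U" "Hausdorff_space X" "x \<in> topspace X" "y \<in> topspace X" "\<And>i. x \<in> U i \<longleftrightarrow> y \<in> U i"
  shows "x = y"
proof (rule ccontr)
  assume "x \<noteq> y"
  then obtain A B where "openin X A" "openin X B" "x \<in> A" "y \<in> B" "disjnt A B"
    using assms(2-4) unfolding Hausdorff_space_def by metis
  then show False
    using clopen_baseD(3)[OF assms(1), of A x] assms(5) by (auto simp: disjnt_iff)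
qed

lemma continuous_map_clopen_base:
  assumes V: "clopen_base Y V" and U: "\<And>i. openin X (U i)"
    and h: "\<And>x. x \<in> topspace X \<Longrightarrow> h x \<in> topspace Y \<and> (\<forall>i. x \<in> U i \<longleftrightarrow> h x \<in> V i)"
  shows "continuous_map X Y h"
  unfolding continuous_map_def
proof (intro conjI allI impI)
  show "h \<in> topspace X \<rightarrow> topspace Y" using h by blast
  fix W assume W: "openin Y W"
  show "openin X {x \<in> topspace X. h x \<in> W}"
  proof (subst openin_subopen, intro ballI)
    fix x assume x: "x \<in> {x \<in> topspace X. h x \<in> W}"
    then obtain n where n: "h x \<in> V n" "V n \<subseteq> W" using clopen_baseD(3)[OF V W, of "h x"] by auto
    have "U n \<subseteq> {x \<in> topspace X. h x \<in> W}"
      using h n(2) openin_subset[OF U] by blast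
    moreover have "x \<in> U n" using h n(1) x by blast
    ultimately show "\<exists>T. openin X T \<and> x \<in> T \<and> T \<subseteq> {x \<in> topspace X. h x \<in> W}" using U by blast
  qed
qed

text \<open>Matching points with equal codes is a bijection that respects the bases, hence a homeomorphism.\<close>
lemma signature_determines_graph:
  assumes X: "zdmc_space X" "clopen_base X U" "closed_reflexive X R"
    and Y: "zdmc_space Y" "clopen_base Y V" "closed_reflexive Y S"
    and sig: "signature U R = signature V S"
  shows "\<exists>h. homeomorphic_map X Y h \<and>
    (\<forall>x\<in>topspace X. \<forall>y\<in>topspace X. (x, y) \<in> R \<longleftrightarrow> (h x, h y) \<in> S)"
proof -
  have "\<forall>x\<in>topspace X. \<exists>y\<in>topspace Y. \<forall>i. x \<in> U i \<longleftrightarrow> y \<in> V i"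
    using signature_point[OF zdmc_compact[OF Y(1)] Y(2,3) X(3) sig] by blast
  then obtain h where h: "\<And>x. x \<in> topspace X \<Longrightarrow> h x \<in> topspace Y \<and> (\<forall>i. x \<in> U i \<longleftrightarrow> h x \<in> V i)"
    by metis
  have "\<forall>y\<in>topspace Y. \<exists>x\<in>topspace X. \<forall>i. y \<in> V i \<longleftrightarrow> x \<in> U i"
    using signature_point[OF zdmc_compact[OF X(1)] X(2,3) Y(3) sig[symmetric]] by blast
  then obtain k where k: "\<And>y. y \<in> topspace Y \<Longrightarrow> k y \<in> topspace X \<and> (\<forall>i. y \<in> V i \<longleftrightarrow> k y \<in> U i)"
    by metis
  have kh: "k (h x) = x" if "x \<in> topspace X" for x
    using clopen_base_separates[OF X(2) zdmc_Hausdorff[OF X(1)], of "k (h x)" x] h[OF that] k[of "h x"] that by blast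
  have hk: "h (k y) = y" if "y \<in> topspace Y" for y
    using clopen_base_separates[OF Y(2) zdmc_Hausdorff[OF Y(1)], of "h (k y)" y] k[OF that] h[of "k y"] that by blast
  have "homeomorphic_maps X Y h k"
    using continuous_map_clopen_base[OF Y(2) clopen_baseD(1)[OF X(2)] h]
      continuous_map_clopen_base[OF X(2) clopen_baseD(1)[OF Y(2)] k] kh hk
    by (auto simp: homeomorphic_maps_def)
  then have "homeomorphic_map X Y h" using homeomorphic_maps_map by blast
  moreover have "(h x, h y) \<in> S" if "x \<in> topspace X" "y \<in> topspace X" "(x, y) \<in> R" for x y
    using signature_relation[OF Y(2,3) sig that(3)] h that by blast
  moreover have "(x, y) \<in> R" if "x \<in> topspace X" "y \<in> topspace X" "(h x, h y) \<in> S" for x y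
    using signature_relation[OF X(2,3) sig[symmetric] that(3), of x y] h that by blast
  ultimately show ?thesis by blast
qed

lemma GG_closed_reflexive:
  assumes "G \<in> GG k"
  shows "closed_reflexive (fst G) (snd G \<union> Id_on (topspace (fst G)))"
proof -
  obtain X f where G: "G = (X, induced_graph (topspace X) f)" and X: "zdmc_space X"
    and f: "homeomorphic_map X X f"
    using assms by (auto simp: GG_iff)
  have f_in: "f x \<in> topspace X" if "x \<in> topspace X" for x
    using that f homeomorphic_imp_continuous_map continuous_map_funspace by blast
  let ?P = "prod_topology X X"
  have c: "continuous_map ?P X fst" "continuous_map ?P X snd"
    "continuous_map ?P X (f \<circ> fst)" "continuous_map ?P X (f \<circ> snd)"
    using f homeomorphic_imp_continuous_map continuous_map_fst continuous_map_snd continuous_map_compose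
    by blast+
  have "closedin ?P ({z \<in> topspace ?P. snd z = (f \<circ> fst) z} \<union> {z \<in> topspace ?P. fst z = (f \<circ> snd) z}
      \<union> {z \<in> topspace ?P. fst z = snd z})"
    by (intro closedin_Un closedin_continuous_maps_eq[OF zdmc_Hausdorff[OF X]] c)
  moreover have "snd G \<union> Id_on (topspace X) =
      {z \<in> topspace ?P. snd z = (f \<circ> fst) z} \<union> {z \<in> topspace ?P. fst z = (f \<circ> snd) z}
      \<union> {z \<in> topspace ?P. fst z = snd z}"
    using f_in by (auto simp: G mem_induced_graph Id_on_def)
  ultimately show ?thesis
    by (auto simp: closed_reflexive_def G)
qed

lemma tgraph_iso_refl: "tgraph_iso G G"
  unfolding tgraph_iso_def by (intro exI[of _ id]) auto

lemma tgraph_iso_trans: "tgraph_iso G H \<Longrightarrow> tgraph_iso H K \<Longrightarrow> tgraph_iso G K"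
proof -
  assume "tgraph_iso G H" "tgraph_iso H K"
  then obtain h k where h: "homeomorphic_map (fst G) (fst H) h"
    "\<forall>x\<in>topspace (fst G). \<forall>y\<in>topspace (fst G). (x, y) \<in> snd G \<longleftrightarrow> (h x, h y) \<in> snd H"
    and k: "homeomorphic_map (fst H) (fst K) k"
    "\<forall>x\<in>topspace (fst H). \<forall>y\<in>topspace (fst H). (x, y) \<in> snd H \<longleftrightarrow> (k x, k y) \<in> snd K"
    unfolding tgraph_iso_def by blast
  have "h x \<in> topspace (fst H)" if "x \<in> topspace (fst G)" for x
    using that h(1) homeomorphic_imp_continuous_map continuous_map_funspace by blast
  then show ?thesis
    unfolding tgraph_iso_def using h k homeomorphic_map_compose[OF h(1) k(1)]
    by (intro exI[of _ "k \<circ> h"]) simp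
qed

lemma tgraph_iso_sym: "tgraph_iso G H \<Longrightarrow> tgraph_iso H G"
proof -
  assume "tgraph_iso G H"
  then obtain h where h: "homeomorphic_map (fst G) (fst H) h"
    "\<forall>x\<in>topspace (fst G). \<forall>y\<in>topspace (fst G). (x, y) \<in> snd G \<longleftrightarrow> (h x, h y) \<in> snd H"
    unfolding tgraph_iso_def by blast
  obtain k where k: "homeomorphic_maps (fst G) (fst H) h k"
    using h(1) homeomorphic_map_maps by blast
  then have "homeomorphic_map (fst H) (fst G) k" using homeomorphic_maps_map by blast
  moreover have "k x \<in> topspace (fst G)" "h (k x) = x" if "x \<in> topspace (fst H)" for x
    using k that by (auto simp: homeomorphic_maps_def continuous_map_def)
  ultimately show ?thesis
    unfolding tgraph_iso_def using h(2) by (intro exI[of _ k]) simp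
qed

lemma tgraph_iso_imp_reducible:
  assumes "tgraph_iso G H" "G \<in> GG k"
  shows "G \<preceq>\<^sub>c H"
proof -
  obtain h where h: "homeomorphic_map (fst G) (fst H) h"
    "\<forall>x\<in>topspace (fst G). \<forall>y\<in>topspace (fst G). (x, y) \<in> snd G \<longleftrightarrow> (h x, h y) \<in> snd H"
    using assms(1) unfolding tgraph_iso_def by blast
  have "snd G \<subseteq> topspace (fst G) \<times> topspace (fst G)"
    using GG_closed_reflexive[OF assms(2)] closedin_subset by (fastforce simp: closed_reflexive_def)
  then show ?thesis
    unfolding reducible_c_def using h homeomorphic_imp_continuous_map by blast
qed

text \<open>By compactness the signature determines the graph up to isomorphism, and a signature is a set of
  (triples of) natural numbers.\<close>
lemma iso_classes_lepoll_continuum: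
  assumes "B \<subseteq> GG k"
  shows "iso_classes B \<lesssim> continuum"
proof -
  define U where "U G = (SOME V. clopen_base (fst G) V)" for G :: "'a tgraph"
  define \<sigma> where "\<sigma> G = to_nat ` signature (U G) (snd G \<union> Id_on (topspace (fst G)))" for G :: "'a tgraph"
  have U: "zdmc_space (fst G)" "clopen_base (fst G) (U G)" if "G \<in> GG k" for G
  proof -
    show "zdmc_space (fst G)" using that by (auto simp: GG_iff)
    then show "clopen_base (fst G) (U G)"
      unfolding U_def by (metis zdmc_clopen_base someI)
  qed
  have irrefl: "(x, x) \<notin> snd G" if "G \<in> GG k" for G :: "'a tgraph" and x
    using that by (auto simp: GG_iff mem_induced_graph)
  have iso: "tgraph_iso G H" if G: "G \<in> GG k" and H: "H \<in> GG k" and eq: "\<sigma> G = \<sigma> H" for G H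
  proof -
    have "signature (U G) (snd G \<union> Id_on (topspace (fst G))) = signature (U H) (snd H \<union> Id_on (topspace (fst H)))"
      using eq by (simp add: \<sigma>_def inj_image_eq_iff)
    from signature_determines_graph[OF U[OF G] GG_closed_reflexive[OF G] U[OF H] GG_closed_reflexive[OF H] this]
    obtain h where h: "homeomorphic_map (fst G) (fst H) h"
      "\<forall>x\<in>topspace (fst G). \<forall>y\<in>topspace (fst G). (x, y) \<in> snd G \<union> Id_on (topspace (fst G)) \<longleftrightarrow>
        (h x, h y) \<in> snd H \<union> Id_on (topspace (fst H))" by blast
    have hG: "inj_on h (topspace (fst G))" "h \<in> topspace (fst G) \<rightarrow> topspace (fst H)"
      using h(1) homeomorphic_imp_injective_map homeomorphic_imp_continuous_map continuous_map_funspace by blast+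
    have "(x, y) \<in> snd G \<longleftrightarrow> (h x, h y) \<in> snd H" if "x \<in> topspace (fst G)" "y \<in> topspace (fst G)" for x y
    proof (cases "x = y")
      case True
      then show ?thesis using irrefl G H by blast
    next
      case False
      then have "h x \<noteq> h y" using that hG(1) by (auto dest: inj_onD)
      moreover have "(x, y) \<in> snd G \<union> Id_on (topspace (fst G)) \<longleftrightarrow> (h x, h y) \<in> snd H \<union> Id_on (topspace (fst H))"
        by (rule h(2)[rule_format, OF that])
      ultimately show ?thesis using False by (simp add: Id_on_iff)
    qed
    with h(1) show ?thesis unfolding tgraph_iso_def by blast
  qed
  have class_eq: "{K. tgraph_iso G K} = {K. tgraph_iso H K}"
    if "G \<in> GG k" "H \<in> GG k" "\<sigma> G = \<sigma> H" for G H
    using iso[OF that] tgraph_iso_sym tgraph_iso_trans by blast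
  have "iso_classes B = (\<lambda>s. {K. tgraph_iso (inv_into B \<sigma> s) K}) ` \<sigma> ` B"
    unfolding iso_classes_def image_image
  proof (rule image_cong[OF refl])
    fix G assume G: "G \<in> B"
    then have "inv_into B \<sigma> (\<sigma> G) \<in> B" "\<sigma> (inv_into B \<sigma> (\<sigma> G)) = \<sigma> G"
      by (simp_all add: inv_into_into f_inv_into_f)
    with G assms show "{K. tgraph_iso G K} = {K. tgraph_iso (inv_into B \<sigma> (\<sigma> G)) K}"
      by (intro class_eq) auto
  qed
  then have "iso_classes B \<lesssim> \<sigma> ` B" by (simp only: image_lepoll)
  also have "\<sigma> ` B \<lesssim> continuum" by (rule subset_imp_lepoll) simp
  finally show ?thesis .
qed

section \<open>Almost disjoint families\<close>

text \<open>Codes of the finite initial segments of \<open>\<alpha>\<close>; the segments of two distinct sets eventually differ, so that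
  the ranges are almost disjoint.\<close>
definition branch :: "nat set \<Rightarrow> nat \<Rightarrow> nat" where
  "branch \<alpha> n = prod_encode (n, set_encode (\<alpha> \<inter> {..<n}))"

lemma branch_eq_iff: "branch \<alpha> m = branch \<beta> n \<longleftrightarrow> m = n \<and> \<alpha> \<inter> {..<n} = \<beta> \<inter> {..<n}"
  unfolding branch_def by (auto simp: set_encode_eq)

lemma branch_ge: "n \<le> branch \<alpha> n"
  unfolding branch_def by (rule le_prod_encode_1)

lemma inj_branch: "inj (branch \<alpha>)"
  by (rule injI) (simp add: branch_eq_iff)

lemma branches_almost_disjoint:
  assumes "\<alpha> \<noteq> \<beta>"
  obtains n0 where "\<And>n m. n0 \<le> n \<Longrightarrow> branch \<alpha> n \<noteq> branch \<beta> m"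
proof -
  obtain a where "a \<in> \<alpha> \<longleftrightarrow> a \<notin> \<beta>" using assms by blast
  then have "\<alpha> \<inter> {..<n} \<noteq> \<beta> \<inter> {..<n}" if "Suc a \<le> n" for n
    using that by (metis Int_iff Suc_le_eq lessThan_iff)
  then show ?thesis
    using that[of "Suc a"] by (metis branch_eq_iff)
qed

definition odd_prime :: "nat \<Rightarrow> nat" where
  "odd_prime = enumerate {q. prime q \<and> 2 < q}"

lemma infinite_odd_primes: "infinite {q::nat. prime q \<and> 2 < q}"
proof -
  have "infinite ({q::nat. prime q} - {..2})"
    using primes_infinite by (simp add: Diff_infinite_finite)
  moreover have "{q::nat. prime q} - {..2} = {q. prime q \<and> 2 < q}" by auto
  ultimately show ?thesis by simp
qed

lemma odd_prime: "prime (odd_prime n)" "2 < odd_prime n" "n \<le> odd_prime n"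
  using enumerate_in_set[OF infinite_odd_primes, of n] le_enumerate[OF infinite_odd_primes, of n]
  by (auto simp: odd_prime_def)

lemma odd_prime_inject: "odd_prime m = odd_prime n \<longleftrightarrow> m = n"
  using strict_mono_enumerate[OF infinite_odd_primes]
  by (auto simp: odd_prime_def strict_mono_eq)

lemma coprime_odd_primes: "m \<noteq> n \<Longrightarrow> coprime (int (odd_prime m)) (int (odd_prime n))"
  using primes_coprime[OF odd_prime(1,1), of m n] by (simp add: odd_prime_inject)

definition modulus :: "nat set \<Rightarrow> nat \<Rightarrow> int" where
  "modulus \<alpha> i = int (odd_prime (branch \<alpha> i))"

lemma odd_moduli_modulus: "odd_moduli (modulus \<alpha>)"
proof
  fix i j
  show "odd (modulus \<alpha> i)"
    using prime_odd_nat[OF odd_prime(1,2)] by (simp add: modulus_def)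
  show "3 \<le> modulus \<alpha> i"
    using odd_prime(2)[of "branch \<alpha> i"] by (simp add: modulus_def)
  show "i \<noteq> j \<Longrightarrow> coprime (modulus \<alpha> i) (modulus \<alpha> j)"
    unfolding modulus_def by (rule coprime_odd_primes) (simp add: branch_eq_iff)
qed

text \<open>Almost disjointness, rather than mere incomparability of the sets of primes, is what provides arbitrarily large
  moduli of \<open>\<beta>\<close> that are coprime to all the moduli of \<open>\<alpha>\<close>.\<close>
lemma odometers_incomparable:
  assumes "\<alpha> \<noteq> \<beta>"
  shows "\<not> odometer_graph (modulus \<alpha>) \<preceq>\<^sub>c odometer_graph (modulus \<beta>)"
proof (rule no_reduction_between_odometers[OF odd_moduli_modulus odd_moduli_modulus])
  fix b :: int
  obtain n0 where n0: "\<And>n m. n0 \<le> n \<Longrightarrow> branch \<beta> n \<noteq> branch \<alpha> m"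
    using branches_almost_disjoint[of \<beta> \<alpha>] assms by metis
  define i where "i = max n0 (Suc (nat b))"
  have "Suc (nat b) \<le> odd_prime (branch \<beta> i)"
    using odd_prime(3)[of "branch \<beta> i"] branch_ge[of i \<beta>] by (simp add: i_def)
  then have "b < modulus \<beta> i" by (simp add: modulus_def)
  moreover have "coprime (modulus \<beta> i) (modulus \<alpha> j)" for j
    unfolding modulus_def by (rule coprime_odd_primes, rule n0) (simp add: i_def)
  ultimately show "\<exists>i. b < modulus \<beta> i \<and> (\<forall>j. coprime (modulus \<beta> i) (modulus \<alpha> j))" by blast
qed

text \<open>The successor keeps the index 0 away, as the block of that index is a single fixed point rather than a cycle.\<close>
lemma cycles_incomparable:
  assumes "\<alpha> \<noteq> \<beta>"
  shows "\<not> cycles_graph (range (\<lambda>n. Suc (branch \<alpha> n))) \<preceq>\<^sup>i\<^sub>c cycles_graph (range (\<lambda>n. Suc (branch \<beta> n)))"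
proof
  assume "cycles_graph (range (\<lambda>n. Suc (branch \<alpha> n))) \<preceq>\<^sup>i\<^sub>c cycles_graph (range (\<lambda>n. Suc (branch \<beta> n)))"
  then have "range (\<lambda>n. Suc (branch \<alpha> n)) \<subseteq> range (\<lambda>n. Suc (branch \<beta> n))"
    by (rule cycles_graph_reducible_ic) auto
  moreover obtain n0 where "\<And>n m. n0 \<le> n \<Longrightarrow> branch \<alpha> n \<noteq> branch \<beta> m"
    using branches_almost_disjoint[OF assms] by metis
  ultimately show False by (auto simp: subset_iff)
qed

lemma branch_cycles_in_GG: "cycles_graph (range (\<lambda>n. Suc (branch \<alpha> n))) \<in> GG k"
proof (rule cycles_graph_in_GG)
  have "inj (\<lambda>n. Suc (branch \<alpha> n))" using inj_branch[of \<alpha>] by (simp add: inj_def)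
  then show "infinite (range (\<lambda>n. Suc (branch \<alpha> n)))" by (rule range_inj_infinite)
qed auto

section \<open>Bases, descending sequences and antichains\<close>

text \<open>Reflexivity turns incomparability into injectivity of the family.\<close>
lemma antichain_of_family:
  fixes F :: "nat set \<Rightarrow> 'g"
  assumes "\<And>\<alpha>. F \<alpha> \<in> \<Gamma>" "\<And>G. le G G" "\<And>\<alpha> \<beta>. \<alpha> \<noteq> \<beta> \<Longrightarrow> \<not> le (F \<alpha>) (F \<beta>)"
  shows "\<exists>A. is_antichain le \<Gamma> A \<and> A \<approx> continuum"
proof (intro exI conjI)
  show "is_antichain le \<Gamma> (range F)"
    using assms unfolding is_antichain_def by (metis (no_types, lifting) imageE image_subset_iff)
  have "inj F" by (rule injI) (metis assms(2,3))
  then show "range F \<approx> continuum" by (rule inj_on_image_eqpoll_self)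
qed

text \<open>An element of the basis below the odometer of \<open>\<alpha>\<close> is also above it, by rigidity. Distinct odometers
  being incomparable, these elements are pairwise non-isomorphic.\<close>
lemma basis_size:
  fixes B :: "'u tgraph set"
  assumes universe: "continuum \<lesssim> (UNIV :: 'u set)" and B: "is_basis (\<preceq>\<^sup>i\<^sub>c) (GG 2) B"
  shows "continuum \<lesssim> B \<and> iso_classes B \<approx> continuum"
proof -
  obtain j :: "(nat \<Rightarrow> int) \<Rightarrow> 'u" where j: "inj j" using inj_sequences_into[OF universe] by blast
  let ?O = "\<lambda>\<alpha>. odometer_graph (modulus \<alpha>)"
  have O: "?O \<alpha> \<in> GG 2" for \<alpha>
    by (rule odd_moduli.odometer_graph_in_GG[OF odd_moduli_modulus])
  have "\<forall>\<alpha>. \<exists>H\<in>B. H \<preceq>\<^sup>i\<^sub>c copy_graph j (?O \<alpha>)"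
    using B copy_graph(1)[OF j O] unfolding is_basis_def by blast
  then obtain H where H: "\<And>\<alpha>. H \<alpha> \<in> B" "\<And>\<alpha>. H \<alpha> \<preceq>\<^sup>i\<^sub>c copy_graph j (?O \<alpha>)" by metis
  have HG: "H \<alpha> \<in> GG 2" for \<alpha> using H(1) B by (auto simp: is_basis_def)
  have HO: "H \<alpha> \<preceq>\<^sup>i\<^sub>c ?O \<alpha>" for \<alpha>
    using reducible_ic_trans[OF H(2) copy_graph(3)[OF j O]] .
  have OH: "?O \<alpha> \<preceq>\<^sub>c H \<alpha>" for \<alpha>
    by (rule odometer_graph_rigid[OF odd_moduli_modulus HG HO])
  have "inj (\<lambda>\<alpha>. {K :: 'u tgraph. tgraph_iso (H \<alpha>) K})"
  proof (rule injI)
    fix \<alpha> \<beta> assume "{K :: 'u tgraph. tgraph_iso (H \<alpha>) K} = {K. tgraph_iso (H \<beta>) K}"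
    then have "tgraph_iso (H \<alpha>) (H \<beta>)" by (metis (mono_tags) mem_Collect_eq tgraph_iso_refl)
    then have "?O \<alpha> \<preceq>\<^sub>c ?O \<beta>"
      using reducible_c_trans[OF reducible_c_trans[OF OH tgraph_iso_imp_reducible[OF _ HG]] reducible_ic_imp_c[OF HO]]
      by blast
    then show "\<alpha> = \<beta>" using odometers_incomparable by blast
  qed
  then have "continuum \<lesssim> iso_classes B"
    unfolding lepoll_def iso_classes_def using H(1) by blast
  moreover have "iso_classes B \<lesssim> B" unfolding iso_classes_def by (rule image_lepoll)
  moreover have "iso_classes B \<lesssim> continuum"
    using B by (intro iso_classes_lepoll_continuum) (auto simp: is_basis_def)
  ultimately show ?thesis
    using lepoll_antisym lepoll_trans by blast
qed

text \<open>Breaking up the shortest cycle into isolated vertices gives a subgraph, into which that cycle does not map. The same sequence witnesses both claims,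
  as its steps down are injective and there are no steps up at all.\<close>
lemma GG_not_well_founded:
  assumes universe: "continuum \<lesssim> (UNIV :: 'u set)"
  shows "not_well_founded (\<preceq>\<^sup>i\<^sub>c) (GG k :: 'u tgraph set)" "not_well_founded (\<preceq>\<^sub>c) (GG k :: 'u tgraph set)"
proof -
  obtain j :: "(nat \<Rightarrow> nat) \<Rightarrow> 'u" where j: "inj j" using inj_sequences_into[OF universe] by blast
  let ?C = "\<lambda>n. cycles_graph {n<..}"
  define s where "s n = copy_graph j (?C n)" for n
  have C: "?C n \<in> GG k" for n by (rule cycles_graph_in_GG) (auto simp: infinite_Ioi)
  have s: "s n \<in> GG k" for n unfolding s_def by (rule copy_graph(1)[OF j C])
  have down: "s (Suc n) \<preceq>\<^sup>i\<^sub>c s n" for n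
    unfolding s_def
    by (rule reducible_ic_trans[OF copy_graph(3)[OF j C]], rule reducible_ic_trans[OF _ copy_graph(2)[OF j C]])
      (rule cycles_graph_mono, auto)
  have up: "\<not> s n \<preceq>\<^sub>c s (Suc n)" for n
  proof
    assume "s n \<preceq>\<^sub>c s (Suc n)"
    then have "?C n \<preceq>\<^sub>c ?C (Suc n)"
      unfolding s_def
      using reducible_c_trans[OF reducible_ic_imp_c[OF copy_graph(2)[OF j C]]]
        reducible_c_trans[OF _ reducible_ic_imp_c[OF copy_graph(3)[OF j C]]] by blast
    from cycles_graph_reducible_c[OF this, of "Suc n"] show False by auto
  qed
  show "not_well_founded (\<preceq>\<^sup>i\<^sub>c) (GG k :: 'u tgraph set)" "not_well_founded (\<preceq>\<^sub>c) (GG k :: 'u tgraph set)"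
    unfolding not_well_founded_def using s down up reducible_ic_imp_c by blast+
qed

lemma GG_antichain_ic:
  assumes universe: "continuum \<lesssim> (UNIV :: 'u set)"
  shows "\<exists>A. is_antichain (\<preceq>\<^sup>i\<^sub>c) (GG k :: 'u tgraph set) A \<and> A \<approx> continuum"
proof -
  obtain j :: "(nat \<Rightarrow> nat) \<Rightarrow> 'u" where j: "inj j" using inj_sequences_into[OF universe] by blast
  show ?thesis
  proof (rule antichain_of_family)
    show "copy_graph j (cycles_graph (range (\<lambda>n. Suc (branch \<alpha> n)))) \<in> GG k" for \<alpha>
      by (rule copy_graph(1)[OF j branch_cycles_in_GG])
    show "\<not> copy_graph j (cycles_graph (range (\<lambda>n. Suc (branch \<alpha> n)))) \<preceq>\<^sup>i\<^sub>c
        copy_graph j (cycles_graph (range (\<lambda>n. Suc (branch \<beta> n))))" if "\<alpha> \<noteq> \<beta>" for \<alpha> \<beta>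
      using cycles_incomparable[OF that] reducible_ic_trans
        copy_graph(2,3)[OF j branch_cycles_in_GG] by metis
  qed (rule reducible_ic_refl)
qed

lemma GG_antichain_c:
  assumes universe: "continuum \<lesssim> (UNIV :: 'u set)" and k: "k \<le> 2"
  shows "\<exists>A. is_antichain (\<preceq>\<^sub>c) (GG k :: 'u tgraph set) A \<and> A \<approx> continuum"
proof -
  obtain j :: "(nat \<Rightarrow> int) \<Rightarrow> 'u" where j: "inj j" using inj_sequences_into[OF universe] by blast
  have O: "odometer_graph (modulus \<alpha>) \<in> GG 2" for \<alpha>
    by (rule odd_moduli.odometer_graph_in_GG[OF odd_moduli_modulus])
  show ?thesis
  proof (rule antichain_of_family)
    show "copy_graph j (odometer_graph (modulus \<alpha>)) \<in> GG k" for \<alpha>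
      using copy_graph(1)[OF j O] GG_antimono[OF k] by blast
    show "\<not> copy_graph j (odometer_graph (modulus \<alpha>)) \<preceq>\<^sub>c copy_graph j (odometer_graph (modulus \<beta>))"
      if "\<alpha> \<noteq> \<beta>" for \<alpha> \<beta>
      using odometers_incomparable[OF that] reducible_c_trans
        reducible_ic_imp_c[OF copy_graph(2)[OF j O]] reducible_ic_imp_c[OF copy_graph(3)[OF j O]] by metis
  qed (rule reducible_ic_imp_c[OF reducible_ic_refl])
qed

theorem theorem1p11:
  assumes universe: "continuum \<lesssim> (UNIV :: 'u set)"
  shows "(one_graph \<in> GG 0 \<and> (\<forall>G \<in> (GG 0 :: 'a tgraph set). one_graph \<preceq>\<^sup>i\<^sub>c G)) \<and>
    (two_graph \<in> GG 1 \<and> (\<forall>G \<in> (GG 1 :: 'a tgraph set). two_graph \<preceq>\<^sup>i\<^sub>c G)) \<and>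
    (\<forall>B. is_basis (\<preceq>\<^sup>i\<^sub>c) (GG 2 :: 'u tgraph set) B \<longrightarrow>
           continuum \<lesssim> B \<and> iso_classes B \<approx> continuum) \<and>
    (X1_graph \<in> GG 3 \<and> (\<forall>G \<in> (GG 3 :: 'a tgraph set). X1_graph \<preceq>\<^sup>i\<^sub>c G)) \<and>
    (\<forall>\<kappa>\<in>{0, 1, 2, 3}. not_well_founded (\<preceq>\<^sup>i\<^sub>c) (GG \<kappa> :: 'u tgraph set) \<and>
           not_well_founded (\<preceq>\<^sub>c) (GG \<kappa> :: 'u tgraph set)) \<and>
    (\<forall>\<kappa>\<in>{0, 1, 2, 3}. \<exists>A. is_antichain (\<preceq>\<^sup>i\<^sub>c) (GG \<kappa> :: 'u tgraph set) A \<and> A \<approx> continuum) \<and>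
    (\<forall>\<kappa>\<in>{0, 1, 2}. \<exists>A. is_antichain (\<preceq>\<^sub>c) (GG \<kappa> :: 'u tgraph set) A \<and> A \<approx> continuum)"
proof (intro conjI ballI allI impI)
  show "one_graph \<in> GG 0" "two_graph \<in> GG 1" "X1_graph \<in> GG 3"
    by (rule one_graph_in_GG two_graph_in_GG X1_graph_in_GG)+
  show "one_graph \<preceq>\<^sup>i\<^sub>c G" if "G \<in> GG 0" for G :: "'a tgraph" by (rule one_graph_minimum[OF that])
  show "two_graph \<preceq>\<^sup>i\<^sub>c G" if "G \<in> GG 1" for G :: "'a tgraph" by (rule two_graph_minimum[OF that])
  show "X1_graph \<preceq>\<^sup>i\<^sub>c G" if "G \<in> GG 3" for G :: "'a tgraph" by (rule X1_graph_minimum[OF that])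
  show "continuum \<lesssim> B" "iso_classes B \<approx> continuum" if "is_basis (\<preceq>\<^sup>i\<^sub>c) (GG 2) B" for B :: "'u tgraph set"
    using basis_size[OF universe that] by blast+
  show "not_well_founded (\<preceq>\<^sup>i\<^sub>c) (GG \<kappa> :: 'u tgraph set)" "not_well_founded (\<preceq>\<^sub>c) (GG \<kappa> :: 'u tgraph set)" for \<kappa>
    by (rule GG_not_well_founded[OF universe])+
  show "\<exists>A. is_antichain (\<preceq>\<^sup>i\<^sub>c) (GG \<kappa> :: 'u tgraph set) A \<and> A \<approx> continuum" for \<kappa>
    by (rule GG_antichain_ic[OF universe])
  show "\<exists>A. is_antichain (\<preceq>\<^sub>c) (GG \<kappa> :: 'u tgraph set) A \<and> A \<approx> continuum" if "\<kappa> \<in> {0, 1, 2}" for \<kappa>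
    by (rule GG_antichain_c[OF universe]) (use that in auto)
qed

end
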